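(* Let $\mathbb K$ be a field and let $M$ be a finitely generated, cancellative binoid that is torsion-free up to nilpotence. Let $i:\operatorname{Spec}M\to\operatorname{Spec}\mathbb K[M]$ be the continuous map $\mathfrak p\mapsto\mathbb K[\mathfrak p]$, both spaces carrying the Zariski topology. Then the pushforward $i_*$ of sheaves of abelian groups along $i$ is exact.
   Context: A (commutative) binoid is a commutative monoid $(M,+,0)$ with an absorbing element $\infty$; $M^\bullet=M\smallsetminus\{\infty\}$. $M$ is cancellative if $a+b=a+c\neq\infty$ implies $b=c$, and torsion-free up to nilpotence if $na=nb\neq\infty$ with $n\geq1$ implies $a=b$. A prime ideal of $M$ is a subset $\mathfrak p\ni\infty$ with $\mathfrak p+M\subseteq\mathfrak p$ and $M\smallsetminus\mathfrak p$ a submonoid; $\operatorname{Spec}M$ is the set of prime ideals with the Zariski topology, with basis the sets $D(f)=\{\mathfrak p\mid f\notin\mathfrak p\}$, $f\in M$. The binoid algebra $\mathbb K[M]$ is the $\mathbb K$-algebra with $\mathbb K$-basis $\{T^a\mid a\in M^\bullet\}$ and multiplication $T^aT^b=T^{a+b}$, where $T^\infty=0$. For an ideal $\mathfrak p$ of $M$, $\mathbb K[\mathfrak p]$ is the ideal of $\mathbb K[M]$ spanned by the $T^a$ with $a\in\mathfrak p$; when $M$ is finitely generated, cancellative and torsion-free up to nilpotence, it is a prime ideal when $\mathfrak p$ is prime, and $i$ is continuous. *)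

theory Defs
  imports "HOL-Algebra.Algebra" "HOL-Analysis.Analysis"
begin

text \<open>
  Binoids are written multiplicatively, following HOL-Algebra: the additive \<open>a + b\<close>, \<open>0\<close>, \<open>n a\<close>
  and \<open>\<infinity>\<close> become \<open>a \<otimes>\<^bsub>M\<^esub> b\<close>, \<open>\<one>\<^bsub>M\<^esub>\<close>, \<open>a [^]\<^bsub>M\<^esub> n\<close> and \<open>absorb M\<close>.
\<close>

record 'm binoid = "'m monoid" +
  absorb :: 'm

locale binoid = comm_monoid M for M (structure) +
  assumes absorb_closed: "absorb M \<in> carrier M"
    and absorb_mult: "a \<in> carrier M \<Longrightarrow> absorb M \<otimes> a = absorb M"

definition nonabsorb :: "('m, 'x) binoid_scheme \<Rightarrow> 'm set"
  where "nonabsorb M = carrier M - {absorb M}"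

definition fin_gen_binoid :: "('m, 'x) binoid_scheme \<Rightarrow> bool"
  where "fin_gen_binoid M \<longleftrightarrow>
    (\<exists>A. finite A \<and> A \<subseteq> carrier M \<and>
       carrier M = \<Inter>{H. submonoid H M \<and> absorb M \<in> H \<and> A \<subseteq> H})"

definition cancellative_binoid :: "('m, 'x) binoid_scheme \<Rightarrow> bool"
  where "cancellative_binoid M \<longleftrightarrow>
    (\<forall>a\<in>carrier M. \<forall>b\<in>carrier M. \<forall>c\<in>carrier M.
       a \<otimes>\<^bsub>M\<^esub> b = a \<otimes>\<^bsub>M\<^esub> c \<and> a \<otimes>\<^bsub>M\<^esub> c \<noteq> absorb M \<longrightarrow> b = c)"

definition torsion_free_up_to_nilpotence :: "('m, 'x) binoid_scheme \<Rightarrow> bool"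
  where "torsion_free_up_to_nilpotence M \<longleftrightarrow>
    (\<forall>a\<in>carrier M. \<forall>b\<in>carrier M. \<forall>n::nat. n \<ge> 1 \<and>
       a [^]\<^bsub>M\<^esub> n = b [^]\<^bsub>M\<^esub> n \<and> b [^]\<^bsub>M\<^esub> n \<noteq> absorb M \<longrightarrow> a = b)"

definition binoid_prime :: "'m set \<Rightarrow> ('m, 'x) binoid_scheme \<Rightarrow> bool"
  where "binoid_prime p M \<longleftrightarrow>
    p \<subseteq> carrier M \<and> absorb M \<in> p \<and>
    (\<forall>a\<in>p. \<forall>b\<in>carrier M. a \<otimes>\<^bsub>M\<^esub> b \<in> p) \<and>
    submonoid (carrier M - p) M"

text \<open>
  In both spectra below the sets \<open>D(f)\<close> are closed under binary intersection,
  \<open>D(f) \<inter> D(g) = D(f \<otimes> g)\<close>, and \<open>D(\<one>)\<close> is the whole space. Hence they are a basis, not merely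
  a subbasis, of the topology they generate.
\<close>

definition binoid_Spec :: "('m, 'x) binoid_scheme \<Rightarrow> 'm set topology"
  where "binoid_Spec M =
    topology_generated_by {{p. binoid_prime p M \<and> f \<notin> p} | f. f \<in> carrier M}"

definition ring_Spec :: "('r, 'x) ring_scheme \<Rightarrow> 'r set topology"
  where "ring_Spec R =
    topology_generated_by {{P. primeideal P R \<and> f \<notin> P} | f. f \<in> carrier R}"

text \<open>
  An element \<open>\<Sum> f\<^sub>a T\<^sup>a\<close> of the binoid algebra is represented by its coefficient function \<open>f\<close>,
  which has finite support contained in \<open>nonabsorb M\<close>. Products \<open>T\<^sup>a T\<^sup>b\<close> with
  \<open>a \<otimes>\<^bsub>M\<^esub> b = absorb M\<close> vanish because no coefficient is kept at \<open>absorb M\<close>. The unit is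
  \<open>T\<^sup>\<one>\<close>, which is \<open>0\<close> in the degenerate case \<open>\<one>\<^bsub>M\<^esub> = absorb M\<close>.
\<close>

definition binoid_algebra ::
    "('k, 'x) ring_scheme \<Rightarrow> ('m, 'y) binoid_scheme \<Rightarrow> ('m \<Rightarrow> 'k) ring"
  where "binoid_algebra K M =
    \<lparr>carrier = {f. (\<forall>a. f a \<in> carrier K) \<and> finite {a. f a \<noteq> \<zero>\<^bsub>K\<^esub>} \<and>
                  {a. f a \<noteq> \<zero>\<^bsub>K\<^esub>} \<subseteq> nonabsorb M},
     monoid.mult = (\<lambda>f g c. if c \<in> nonabsorb M
               then finsum K (\<lambda>(a, b). f a \<otimes>\<^bsub>K\<^esub> g b)
                 {(a, b). f a \<noteq> \<zero>\<^bsub>K\<^esub> \<and> g b \<noteq> \<zero>\<^bsub>K\<^esub> \<and> a \<otimes>\<^bsub>M\<^esub> b = c}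
               else \<zero>\<^bsub>K\<^esub>),
     monoid.one = (\<lambda>c. if c = \<one>\<^bsub>M\<^esub> \<and> c \<noteq> absorb M then \<one>\<^bsub>K\<^esub> else \<zero>\<^bsub>K\<^esub>),
     ring.zero = (\<lambda>c. \<zero>\<^bsub>K\<^esub>),
     ring.add = (\<lambda>f g c. f c \<oplus>\<^bsub>K\<^esub> g c)\<rparr>"

text \<open>\<open>K[p]\<close>: the linear span of the \<open>T\<^sup>a\<close> with \<open>a \<in> p\<close> (recall \<open>T\<^sup>\<infinity> = 0\<close>).\<close>

definition ideal_extension ::
    "('k, 'x) ring_scheme \<Rightarrow> ('m, 'y) binoid_scheme \<Rightarrow> 'm set \<Rightarrow> ('m \<Rightarrow> 'k) set"
  where "ideal_extension K M p =
    {f \<in> carrier (binoid_algebra K M). {a. f a \<noteq> \<zero>\<^bsub>K\<^esub>} \<subseteq> p}"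

text \<open>
  Abelian groups are commutative groups of HOL-Algebra, in multiplicative notation. Presheaf data
  are only meaningful on open sets.
\<close>

record ('a, 'b) presheaf =
  sections :: "'a set \<Rightarrow> 'b monoid"
  restr :: "'a set \<Rightarrow> 'a set \<Rightarrow> 'b \<Rightarrow> 'b"  \<comment> \<open>\<open>restr F U V\<close> restricts from \<open>U\<close> to \<open>V \<subseteq> U\<close>\<close>

definition ab_presheaf :: "'a topology \<Rightarrow> ('a, 'b) presheaf \<Rightarrow> bool"
  where "ab_presheaf S F \<longleftrightarrow>
    (\<forall>U. openin S U \<longrightarrow> comm_group (sections F U)) \<and>
    (\<forall>U V. openin S U \<and> openin S V \<and> V \<subseteq> U \<longrightarrow>
       restr F U V \<in> hom (sections F U) (sections F V)) \<and>
    (\<forall>U. openin S U \<longrightarrow> (\<forall>s\<in>carrier (sections F U). restr F U U s = s)) \<and>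
    (\<forall>U V W. openin S U \<and> openin S V \<and> openin S W \<and> W \<subseteq> V \<and> V \<subseteq> U \<longrightarrow>
       (\<forall>s\<in>carrier (sections F U). restr F V W (restr F U V s) = restr F U W s))"

text \<open>
  Open covers are sets \<open>\<U>\<close> of open sets, covering \<open>\<Union>\<U>\<close>. The empty cover of \<open>{}\<close> is included, so
  a sheaf has exactly one section over \<open>{}\<close>.
\<close>

definition ab_sheaf :: "'a topology \<Rightarrow> ('a, 'b) presheaf \<Rightarrow> bool"
  where "ab_sheaf S F \<longleftrightarrow> ab_presheaf S F \<and>
    (\<forall>\<U>. (\<forall>V\<in>\<U>. openin S V) \<longrightarrow>
       (\<forall>s\<in>carrier (sections F (\<Union>\<U>)). \<forall>t\<in>carrier (sections F (\<Union>\<U>)).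
          (\<forall>V\<in>\<U>. restr F (\<Union>\<U>) V s = restr F (\<Union>\<U>) V t) \<longrightarrow> s = t) \<and>
       (\<forall>s. (\<forall>V\<in>\<U>. s V \<in> carrier (sections F V)) \<and>
            (\<forall>V\<in>\<U>. \<forall>W\<in>\<U>. restr F V (V \<inter> W) (s V) = restr F W (V \<inter> W) (s W)) \<longrightarrow>
          (\<exists>t\<in>carrier (sections F (\<Union>\<U>)). \<forall>V\<in>\<U>. restr F (\<Union>\<U>) V t = s V)))"

definition sheaf_hom ::
    "'a topology \<Rightarrow> ('a, 'b) presheaf \<Rightarrow> ('a, 'c) presheaf \<Rightarrow> ('a set \<Rightarrow> 'b \<Rightarrow> 'c) \<Rightarrow> bool"
  where "sheaf_hom S F G \<phi> \<longleftrightarrow>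
    (\<forall>U. openin S U \<longrightarrow> \<phi> U \<in> hom (sections F U) (sections G U)) \<and>
    (\<forall>U V. openin S U \<and> openin S V \<and> V \<subseteq> U \<longrightarrow>
       (\<forall>s\<in>carrier (sections F U). \<phi> V (restr F U V s) = restr G U V (\<phi> U s)))"

text \<open>
  The image sheaf of a morphism \<open>\<phi>\<close> into \<open>G\<close>, as a subsheaf of \<open>G\<close>: its sections are those sections
  of \<open>G\<close> that locally lie in the presheaf image.
\<close>

definition sheaf_image ::
    "'a topology \<Rightarrow> ('a, 'b) presheaf \<Rightarrow> ('a, 'c) presheaf \<Rightarrow> ('a set \<Rightarrow> 'b \<Rightarrow> 'c) \<Rightarrow> 'a set \<Rightarrow> 'c set"
  where "sheaf_image S F G \<phi> U =
    {t \<in> carrier (sections G U).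
       \<exists>\<U>. (\<forall>V\<in>\<U>. openin S V) \<and> \<Union>\<U> = U \<and>
           (\<forall>V\<in>\<U>. restr G U V t \<in> \<phi> V ` carrier (sections F V))}"

text \<open>Exactness of \<open>0 \<rightarrow> F \<rightarrow> G \<rightarrow> H \<rightarrow> 0\<close> in the category of sheaves of abelian groups on \<open>S\<close>.\<close>

definition short_exact_sheaves ::
    "'a topology \<Rightarrow> ('a, 'b) presheaf \<Rightarrow> ('a set \<Rightarrow> 'b \<Rightarrow> 'c) \<Rightarrow> ('a, 'c) presheaf
      \<Rightarrow> ('a set \<Rightarrow> 'c \<Rightarrow> 'd) \<Rightarrow> ('a, 'd) presheaf \<Rightarrow> bool"
  where "short_exact_sheaves S F \<phi> G \<psi> H \<longleftrightarrow>
    ab_sheaf S F \<and> ab_sheaf S G \<and> ab_sheaf S H \<and>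
    sheaf_hom S F G \<phi> \<and> sheaf_hom S G H \<psi> \<and>
    (\<forall>U. openin S U \<longrightarrow>
       kernel (sections F U) (sections G U) (\<phi> U) = {\<one>\<^bsub>sections F U\<^esub>} \<and>
       sheaf_image S F G \<phi> U = kernel (sections G U) (sections H U) (\<psi> U) \<and>
       sheaf_image S G H \<psi> U = carrier (sections H U))"

definition open_preimage :: "'a topology \<Rightarrow> ('a \<Rightarrow> 'e) \<Rightarrow> 'e set \<Rightarrow> 'a set"
  where "open_preimage S f V = {x \<in> topspace S. f x \<in> V}"

text \<open>The functor \<open>f\<^sub>*\<close> for \<open>f\<close> with source \<open>S\<close>, on objects and on morphisms.\<close>

definition pushforward :: "'a topology \<Rightarrow> ('a \<Rightarrow> 'e) \<Rightarrow> ('a, 'b) presheaf \<Rightarrow> ('e, 'b) presheaf"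
  where "pushforward S f F =
    \<lparr>sections = (\<lambda>V. sections F (open_preimage S f V)),
     restr = (\<lambda>V W. restr F (open_preimage S f V) (open_preimage S f W))\<rparr>"

definition pushforward_hom ::
    "'a topology \<Rightarrow> ('a \<Rightarrow> 'e) \<Rightarrow> ('a set \<Rightarrow> 'b \<Rightarrow> 'c) \<Rightarrow> 'e set \<Rightarrow> 'b \<Rightarrow> 'c"
  where "pushforward_hom S f \<phi> = (\<lambda>V. \<phi> (open_preimage S f V))"

end

theory Submission
  imports Defs
begin

text \<open>
  Since \<open>M\<close> is finitely generated, every \<open>q\<close> in \<open>Spec M\<close> has a least open neighbourhood
  \<open>D(a) = {p. p \<subseteq> q}\<close>, where \<open>a\<close> is the product of the generators outside \<open>q\<close>. For a prime ideal
  \<open>P\<close> of \<open>K[M]\<close> let \<open>q\<close> consist of the \<open>b\<close> with \<open>T\<^sup>b \<in> P\<close>. Then \<open>K[q] \<subseteq> P\<close>, so every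
  neighbourhood of \<open>P\<close> contains \<open>K[q]\<close>, while the preimage of \<open>D(T\<^sup>a)\<close> is exactly \<open>D(a)\<close>. Hence
  the stalk of \<open>i\<^sub>* F\<close> at \<open>P\<close> is the stalk of \<open>F\<close> at \<open>q\<close>, and exactness is inherited stalkwise.

  Continuity of \<open>i\<close> requires \<open>K[p]\<close> to be prime. The complement of \<open>p\<close> is a cancellative
  torsion-free monoid, on which any finite set of pairs is comparable in some translation-invariant
  partial order; in a product of two elements outside \<open>K[p]\<close> the coefficient at the product of the
  maximal exponents outside \<open>p\<close> does not cancel.
\<close>

section \<open>Unique products in torsion-free monoids\<close>

locale torsion_free_monoid = comm_monoid +
  assumes cancel: "\<lbrakk>a \<in> carrier G; b \<in> carrier G; c \<in> carrier G; a \<otimes> c = b \<otimes> c\<rbrakk> \<Longrightarrow> a = b"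
    and torsion_free: "\<lbrakk>a \<in> carrier G; b \<in> carrier G; 1 \<le> (n::nat); a [^] n = b [^] n\<rbrakk> \<Longrightarrow> a = b"
begin

text \<open>Translation must both preserve and reflect the relation, so that common factors cancel
  as they would in the group of fractions. The order is only partial; totality is arranged on the
  finitely many pairs that matter.\<close>

definition translation_order :: "('a \<times> 'a) set \<Rightarrow> bool"
  where "translation_order R \<longleftrightarrow>
    R \<subseteq> carrier G \<times> carrier G \<and> refl_on (carrier G) R \<and> trans R \<and> antisym R \<and>
    (\<forall>a\<in>carrier G. \<forall>b\<in>carrier G. \<forall>c\<in>carrier G. (a \<otimes> c, b \<otimes> c) \<in> R \<longleftrightarrow> (a, b) \<in> R)"

lemma translation_order_Id: "translation_order (Id_on (carrier G))"
  unfolding translation_order_def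
  by (auto simp: refl_on_def antisym_def trans_def Id_on_iff dest: cancel)

context
  fixes R assumes R: "translation_order R"
begin

lemma order_closed: "(a, b) \<in> R \<Longrightarrow> a \<in> carrier G \<and> b \<in> carrier G"
  using R by (auto simp: translation_order_def)

lemma order_refl: "a \<in> carrier G \<Longrightarrow> (a, a) \<in> R"
  using R by (auto simp: translation_order_def refl_on_def)

lemma order_trans: "(a, b) \<in> R \<Longrightarrow> (b, c) \<in> R \<Longrightarrow> (a, c) \<in> R"
  using R by (auto simp: translation_order_def dest: transD)

lemma order_antisym: "(a, b) \<in> R \<Longrightarrow> (b, a) \<in> R \<Longrightarrow> a = b"
  using R by (auto simp: translation_order_def dest: antisymD)

lemma order_translate_iff:
  "\<lbrakk>a \<in> carrier G; b \<in> carrier G; c \<in> carrier G\<rbrakk> \<Longrightarrow> (a \<otimes> c, b \<otimes> c) \<in> R \<longleftrightarrow> (a, b) \<in> R"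
  using R by (auto simp: translation_order_def)

lemma order_mult:
  assumes "(a, b) \<in> R" "(c, d) \<in> R"
  shows "(a \<otimes> c, b \<otimes> d) \<in> R"
proof -
  have cl: "a \<in> carrier G" "b \<in> carrier G" "c \<in> carrier G" "d \<in> carrier G"
    using assms order_closed by auto
  have "(a \<otimes> c, b \<otimes> c) \<in> R" "(c \<otimes> b, d \<otimes> b) \<in> R"
    using cl assms by (simp_all add: order_translate_iff)
  then show ?thesis
    using cl by (auto simp: m_comm[of _ b] intro: order_trans)
qed

lemma order_pow: "(a, b) \<in> R \<Longrightarrow> (a [^] (n::nat), b [^] n) \<in> R"
  by (induction n) (auto intro: order_refl order_mult)

text \<open>In the group of fractions the condition reads (y/x)^n \<le> b/a: the cone of elements
  above 1 is enlarged by y/x and its powers. Clearing denominators expresses this inside the monoid,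
  and exponent 0 recovers \<open>R\<close>.\<close>

definition adjoin :: "'a \<Rightarrow> 'a \<Rightarrow> ('a \<times> 'a) set"
  where "adjoin x y = {(a, b). a \<in> carrier G \<and> b \<in> carrier G \<and>
    (\<exists>n::nat. (a \<otimes> y [^] n, b \<otimes> x [^] n) \<in> R)}"

text \<open>Chained relations multiply and their exponents add, which gives transitivity.
  Antisymmetry is where \<open>consistent\<close> enters: multiplying the two opposite relations and
  cancelling the common factor gives y^(n+m) \<le> x^(n+m), so n + m = 0 and both pairs already lie
  in \<open>R\<close>.\<close>

lemma adjoin:
  assumes x: "x \<in> carrier G" and y: "y \<in> carrier G"
    and consistent: "\<And>m::nat. 1 \<le> m \<Longrightarrow> (y [^] m, x [^] m) \<notin> R"
  shows "translation_order (adjoin x y)" and "R \<subseteq> adjoin x y" and "(x, y) \<in> adjoin x y"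
proof -
  have sub: "adjoin x y \<subseteq> carrier G \<times> carrier G"
    by (auto simp: adjoin_def)
  have ext: "(a, b) \<in> adjoin x y" if "(a, b) \<in> R" for a b
    using that order_closed[OF that] by (auto simp: adjoin_def intro!: exI[of _ "0::nat"])
  then show "R \<subseteq> adjoin x y"
    by auto
  show "(x, y) \<in> adjoin x y"
    using x y by (auto simp: adjoin_def m_comm intro!: exI[of _ "1::nat"] order_refl)
  have trans: "(a, c) \<in> adjoin x y" if ab: "(a, b) \<in> adjoin x y" and bc: "(b, c) \<in> adjoin x y" for a b c
  proof -
    obtain n m :: nat where n: "(a \<otimes> y [^] n, b \<otimes> x [^] n) \<in> R" and m: "(b \<otimes> y [^] m, c \<otimes> x [^] m) \<in> R"
      using ab bc by (auto simp: adjoin_def)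
    have cl: "a \<in> carrier G" "b \<in> carrier G" "c \<in> carrier G"
      using ab bc by (auto simp: adjoin_def)
    have "((a \<otimes> y [^] n) \<otimes> y [^] m, (b \<otimes> x [^] n) \<otimes> y [^] m) \<in> R"
      using n cl x y by (simp add: order_translate_iff)
    moreover have "((b \<otimes> y [^] m) \<otimes> x [^] n, (c \<otimes> x [^] m) \<otimes> x [^] n) \<in> R"
      using m cl x y by (simp add: order_translate_iff)
    moreover have "(b \<otimes> x [^] n) \<otimes> y [^] m = (b \<otimes> y [^] m) \<otimes> x [^] n"
      using cl x y by (simp add: m_ac)
    ultimately have "((a \<otimes> y [^] n) \<otimes> y [^] m, (c \<otimes> x [^] m) \<otimes> x [^] n) \<in> R"
      by (metis order_trans)
    then have "(a \<otimes> y [^] (n + m), c \<otimes> x [^] (m + n)) \<in> R"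
      using cl x y by (simp add: m_assoc nat_pow_mult)
    then show ?thesis
      using cl by (auto simp: adjoin_def add.commute)
  qed
  have antisym: "a = b" if ab: "(a, b) \<in> adjoin x y" and ba: "(b, a) \<in> adjoin x y" for a b
  proof -
    obtain n m :: nat where n: "(a \<otimes> y [^] n, b \<otimes> x [^] n) \<in> R" and m: "(b \<otimes> y [^] m, a \<otimes> x [^] m) \<in> R"
      using ab ba by (auto simp: adjoin_def)
    have cl: "a \<in> carrier G" "b \<in> carrier G"
      using ab by (auto simp: adjoin_def)
    have rearrange: "(u \<otimes> z [^] n) \<otimes> (v \<otimes> z [^] m) = z [^] (n + m) \<otimes> (u \<otimes> v)"
      if "u \<in> carrier G" "v \<in> carrier G" "z \<in> carrier G" for u v z
      using that by (simp add: m_ac flip: nat_pow_mult)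
    have "(y [^] (n + m) \<otimes> (a \<otimes> b), x [^] (n + m) \<otimes> (a \<otimes> b)) \<in> R"
      using order_mult[OF n m] cl x y by (simp add: rearrange m_comm[of b a])
    then have "(y [^] (n + m), x [^] (n + m)) \<in> R"
      using cl x y by (simp add: order_translate_iff)
    then have "\<not> 1 \<le> n + m"
      using consistent by blast
    then have "n = 0" "m = 0"
      by auto
    then show ?thesis
      using n m cl by (auto intro: order_antisym)
  qed
  have translate: "(a \<otimes> c, b \<otimes> c) \<in> adjoin x y \<longleftrightarrow> (a, b) \<in> adjoin x y"
    if "a \<in> carrier G" "b \<in> carrier G" "c \<in> carrier G" for a b c
  proof -
    have "(a \<otimes> c) \<otimes> y [^] n = (a \<otimes> y [^] n) \<otimes> c" "(b \<otimes> c) \<otimes> x [^] n = (b \<otimes> x [^] n) \<otimes> c" for n :: nat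
      using that x y by (simp_all add: m_ac)
    then show ?thesis
      using that x y by (simp add: adjoin_def order_translate_iff)
  qed
  show "translation_order (adjoin x y)"
    unfolding translation_order_def
  proof (intro conjI ballI)
    show "refl_on (carrier G) (adjoin x y)"
      using ext[OF order_refl] by (rule refl_onI)
    show "trans (adjoin x y)"
      using trans by (rule transI)
    show "antisym (adjoin x y)"
      using antisym by (rule antisymI)
  qed (rule sub, rule translate)
qed

text \<open>
  If neither \<open>(x, y)\<close> nor \<open>(y, x)\<close> can be adjoined consistently, then equal powers of \<open>x\<close> and \<open>y\<close>
  agree, and torsion-freeness gives \<open>x = y\<close>.
\<close>

lemma comparable_extension:
  assumes x: "x \<in> carrier G" and y: "y \<in> carrier G"
  shows "\<exists>R'. translation_order R' \<and> R \<subseteq> R' \<and> ((x, y) \<in> R' \<or> (y, x) \<in> R')"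
proof (cases "(\<exists>m::nat\<ge>1. (y [^] m, x [^] m) \<in> R) \<and> (\<exists>m::nat\<ge>1. (x [^] m, y [^] m) \<in> R)")
  case True
  then obtain m n :: nat where "1 \<le> m" "1 \<le> n" "(y [^] m, x [^] m) \<in> R" "(x [^] n, y [^] n) \<in> R"
    by blast
  then have "((y [^] m) [^] n, (x [^] m) [^] n) \<in> R" "((x [^] n) [^] m, (y [^] n) [^] m) \<in> R"
    using order_pow by blast+
  then have "(y [^] (m * n), x [^] (m * n)) \<in> R" "(x [^] (m * n), y [^] (m * n)) \<in> R"
    using x y by (simp_all add: nat_pow_pow mult.commute)
  then have "x [^] (m * n) = y [^] (m * n)"
    by (rule order_antisym[rotated])
  moreover have "1 \<le> m * n"
    using \<open>1 \<le> m\<close> \<open>1 \<le> n\<close> by simp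
  ultimately have "x = y"
    using torsion_free[OF x y] by blast
  then show ?thesis
    using R x order_refl by blast
next
  case False
  then consider "\<And>m::nat. 1 \<le> m \<Longrightarrow> (y [^] m, x [^] m) \<notin> R" | "\<And>m::nat. 1 \<le> m \<Longrightarrow> (x [^] m, y [^] m) \<notin> R"
    by blast
  then show ?thesis
  proof cases
    case 1
    then show ?thesis using adjoin[OF x y] by blast
  next
    case 2
    then show ?thesis using adjoin[OF y x] by blast
  qed
qed

end

text \<open>Pairs are made comparable one at a time, starting from equality. Each extension contains
  the previous order, so comparabilities already reached survive.\<close>

lemma exists_order_comparing:
  assumes "finite P" "P \<subseteq> carrier G \<times> carrier G"
  shows "\<exists>R. translation_order R \<and> (\<forall>(x, y)\<in>P. (x, y) \<in> R \<or> (y, x) \<in> R)"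
  using assms
proof (induction P rule: finite_induct)
  case empty
  then show ?case using translation_order_Id by blast
next
  case (insert q P)
  obtain x y where q: "q = (x, y)"
    by (cases q)
  then have xy: "x \<in> carrier G" "y \<in> carrier G"
    using insert.prems by simp_all
  obtain R where R: "translation_order R" "\<And>x y. (x, y) \<in> P \<Longrightarrow> (x, y) \<in> R \<or> (y, x) \<in> R"
    using insert.IH insert.prems by fast
  obtain R' where R': "translation_order R'" "R \<subseteq> R'" "(x, y) \<in> R' \<or> (y, x) \<in> R'"
    using comparable_extension[OF R(1) xy] by blast
  have "\<forall>(x, y)\<in>insert q P. (x, y) \<in> R' \<or> (y, x) \<in> R'"
    using R(2) R'(2,3) q by blast
  then show ?case
    using R'(1) by blast
qed

lemma order_has_max:
  assumes R: "translation_order R" and A: "finite A" "A \<noteq> {}" "A \<subseteq> carrier G"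
    and total: "\<And>x y. x \<in> A \<Longrightarrow> y \<in> A \<Longrightarrow> (x, y) \<in> R \<or> (y, x) \<in> R"
  shows "\<exists>m\<in>A. \<forall>a\<in>A. (a, m) \<in> R"
  using A total
proof (induction A rule: finite_ne_induct)
  case (singleton x)
  then show ?case using order_refl[OF R] by auto
next
  case (insert x A)
  then obtain m where m: "m \<in> A" "\<And>a. a \<in> A \<Longrightarrow> (a, m) \<in> R"
    by auto
  show ?case
  proof (cases "(x, m) \<in> R")
    case True
    then show ?thesis using m by auto
  next
    case False
    then have "(m, x) \<in> R" "(x, x) \<in> R"
      using insert.prems m(1) order_refl[OF R] by auto
    then show ?thesis
      using m order_trans[OF R] by blast
  qed
qed

text \<open>The witnesses are the maxima of \<open>A\<close> and \<open>B\<close> in an order that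
  compares all pairs within \<open>A\<close> and within \<open>B\<close>. If a b equals the product
  of the maxima, then \<open>a\<^sub>0 \<otimes> b\<^sub>0\<close> = a b \<le>
  \<open>a\<^sub>0 \<otimes> b\<close>; cancelling \<open>a\<^sub>0\<close> makes \<open>b\<close>
  maximal too, so \<open>b = b\<^sub>0\<close>, and cancelling \<open>b\<^sub>0\<close> gives
  \<open>a = a\<^sub>0\<close>.\<close>

lemma unique_product:
  assumes A: "finite A" "A \<noteq> {}" "A \<subseteq> carrier G" and B: "finite B" "B \<noteq> {}" "B \<subseteq> carrier G"
  shows "\<exists>a\<^sub>0\<in>A. \<exists>b\<^sub>0\<in>B. \<forall>a\<in>A. \<forall>b\<in>B. a \<otimes> b = a\<^sub>0 \<otimes> b\<^sub>0 \<longrightarrow> a = a\<^sub>0 \<and> b = b\<^sub>0"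
proof -
  have "finite (A \<times> A \<union> B \<times> B)" "A \<times> A \<union> B \<times> B \<subseteq> carrier G \<times> carrier G"
    using A B by auto
  then obtain R where R: "translation_order R"
    and total: "\<forall>(x, y)\<in>A \<times> A \<union> B \<times> B. (x, y) \<in> R \<or> (y, x) \<in> R"
    using exists_order_comparing by meson
  have total_A: "(x, y) \<in> R \<or> (y, x) \<in> R" if "x \<in> A" "y \<in> A" for x y
    using total that by blast
  have total_B: "(x, y) \<in> R \<or> (y, x) \<in> R" if "x \<in> B" "y \<in> B" for x y
    using total that by blast
  obtain a\<^sub>0 where a0: "a\<^sub>0 \<in> A" "\<And>a. a \<in> A \<Longrightarrow> (a, a\<^sub>0) \<in> R"
    using order_has_max[OF R A total_A] by blast
  obtain b\<^sub>0 where b0: "b\<^sub>0 \<in> B" "\<And>b. b \<in> B \<Longrightarrow> (b, b\<^sub>0) \<in> R"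
    using order_has_max[OF R B total_B] by blast
  have "a = a\<^sub>0 \<and> b = b\<^sub>0" if a: "a \<in> A" and b: "b \<in> B" and eq: "a \<otimes> b = a\<^sub>0 \<otimes> b\<^sub>0" for a b
  proof -
    have cl: "a \<in> carrier G" "b \<in> carrier G" "a\<^sub>0 \<in> carrier G" "b\<^sub>0 \<in> carrier G"
      using a b a0(1) b0(1) A B by auto
    have "(a\<^sub>0 \<otimes> b\<^sub>0, a\<^sub>0 \<otimes> b) \<in> R"
      using order_mult[OF R a0(2)[OF a] order_refl[OF R cl(2)]] eq by simp
    then have "(b\<^sub>0, b) \<in> R"
      using order_translate_iff[OF R cl(4) cl(2) cl(3)] cl by (simp add: m_comm)
    then have "b = b\<^sub>0"
      using order_antisym[OF R] b0(2)[OF b] by blast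
    then show ?thesis
      using eq cancel[OF cl(1,3,4)] by simp
  qed
  then show ?thesis
    using a0(1) b0(1) by blast
qed

end

section \<open>Binoid algebras\<close>

context abelian_monoid
begin

lemma finsum_swap:
  assumes "finite A" "finite B" "\<And>a b. a \<in> A \<Longrightarrow> b \<in> B \<Longrightarrow> f a b \<in> carrier G"
  shows "(\<Oplus>a\<in>A. \<Oplus>b\<in>B. f a b) = (\<Oplus>b\<in>B. \<Oplus>a\<in>A. f a b)"
  using assms(1,3)
proof (induction A rule: finite_induct)
  case empty
  then show ?case by (simp add: finsum_zero)
next
  case (insert x A)
  have "(\<Oplus>b\<in>B. \<Oplus>a\<in>insert x A. f a b) = (\<Oplus>b\<in>B. f x b \<oplus> (\<Oplus>a\<in>A. f a b))"
    using insert by (intro finsum_cong') (auto intro!: finsum_insert finsum_closed)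
  also have "\<dots> = (\<Oplus>b\<in>B. f x b) \<oplus> (\<Oplus>b\<in>B. \<Oplus>a\<in>A. f a b)"
    using insert by (intro finsum_addf) (auto intro!: finsum_closed)
  also have "\<dots> = (\<Oplus>a\<in>insert x A. \<Oplus>b\<in>B. f a b)"
    using insert by (subst finsum_insert) (auto intro!: finsum_closed)
  finally show ?case ..
qed

lemma finsum_Times:
  assumes "finite A" "finite B" "\<And>a b. a \<in> A \<Longrightarrow> b \<in> B \<Longrightarrow> f a b \<in> carrier G"
  shows "finsum G (\<lambda>(a, b). f a b) (A \<times> B) = (\<Oplus>a\<in>A. \<Oplus>b\<in>B. f a b)"
  using assms(1,3)
proof (induction A rule: finite_induct)
  case empty
  then show ?case by simp
next
  case (insert x A)
  have row: "finsum G (\<lambda>(a, b). f a b) (Pair x ` B) = (\<Oplus>b\<in>B. f x b)"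
    using insert.prems by (subst finsum_reindex) (auto simp: inj_on_def)
  have "insert x A \<times> B = Pair x ` B \<union> A \<times> B"
    by auto
  then have "finsum G (\<lambda>(a, b). f a b) (insert x A \<times> B)
      = finsum G (\<lambda>(a, b). f a b) (Pair x ` B) \<oplus> finsum G (\<lambda>(a, b). f a b) (A \<times> B)"
    using insert assms(2) by (simp only:) (rule finsum_Un_disjoint, auto)
  then show ?case
    using insert by (simp add: row finsum_insert finsum_closed Pi_def)
qed

lemma finsum_delta:
  assumes "finite A" "i \<in> A" "\<And>a. a \<in> A \<Longrightarrow> f a \<in> carrier G"
  shows "(\<Oplus>a\<in>A. if i = a then f a else \<zero>) = f i"
  using assms by (intro finsum_singleton) auto

end

lemma absorb_not_nonabsorb [simp]: "absorb M \<notin> nonabsorb M"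
  by (simp add: nonabsorb_def)

lemma nonabsorb_closed: "a \<in> nonabsorb M \<Longrightarrow> a \<in> carrier M"
  by (simp add: nonabsorb_def)

section \<open>The ring structure of the binoid algebra\<close>

locale binoid_coeffs = R: cring K + M: binoid M
  for K :: "('k, 'x) ring_scheme" (structure) and M :: "('m, 'y) binoid_scheme"
begin

abbreviation alg where "alg \<equiv> binoid_algebra K M"

abbreviation supp where "supp f \<equiv> {a. f a \<noteq> \<zero>}"

text \<open>This is k T^a. The condition \<open>c \<noteq> absorb M\<close> encodes that T^a
  vanishes at the absorbing element, so products of monomials need no separate case there.\<close>

definition monomial :: "'k \<Rightarrow> 'm \<Rightarrow> 'm \<Rightarrow> 'k"
  where "monomial k a = (\<lambda>c. if c = a \<and> c \<noteq> absorb M then k else \<zero>)"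

lemma alg_carrier:
  "f \<in> carrier alg \<longleftrightarrow> (\<forall>a. f a \<in> carrier K) \<and> finite (supp f) \<and> supp f \<subseteq> nonabsorb M"
  by (simp add: binoid_algebra_def)

lemma coeff_closed: "f \<in> carrier alg \<Longrightarrow> f a \<in> carrier K"
  by (simp add: alg_carrier)

lemma finite_supp: "f \<in> carrier alg \<Longrightarrow> finite (supp f)"
  by (simp add: alg_carrier)

lemma supp_nonabsorb: "f \<in> carrier alg \<Longrightarrow> supp f \<subseteq> nonabsorb M"
  by (simp add: alg_carrier)

lemma supp_closed: "f \<in> carrier alg \<Longrightarrow> supp f \<subseteq> carrier M"
  using supp_nonabsorb by (auto simp: nonabsorb_def)

lemma coeff_outside: "f \<in> carrier alg \<Longrightarrow> c \<notin> nonabsorb M \<Longrightarrow> f c = \<zero>"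
  by (auto simp: alg_carrier)

lemma alg_add: "f \<oplus>\<^bsub>alg\<^esub> g = (\<lambda>c. f c \<oplus> g c)"
  by (simp add: binoid_algebra_def)

lemma alg_zero: "\<zero>\<^bsub>alg\<^esub> = (\<lambda>c. \<zero>)"
  by (simp add: binoid_algebra_def)

lemma alg_one: "\<one>\<^bsub>alg\<^esub> = monomial \<one> \<one>\<^bsub>M\<^esub>"
  by (simp add: binoid_algebra_def monomial_def)

lemma alg_mult_outside: "c \<notin> nonabsorb M \<Longrightarrow> (f \<otimes>\<^bsub>alg\<^esub> g) c = \<zero>"
  by (simp add: binoid_algebra_def)

text \<open>The set of contributing pairs is enlarged to a rectangle by adding zero terms. Since
  \<open>A\<close> and \<open>B\<close> may be any finite sets containing the supports, products of
  different elements can be summed over one common index set, as distributivity requires.\<close>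

lemma alg_mult:
  assumes f: "f \<in> carrier alg" and g: "g \<in> carrier alg" and c: "c \<in> nonabsorb M"
    and A: "finite A" "supp f \<subseteq> A" and B: "finite B" "supp g \<subseteq> B"
  shows "(f \<otimes>\<^bsub>alg\<^esub> g) c = (\<Oplus>a\<in>A. \<Oplus>b\<in>B. if a \<otimes>\<^bsub>M\<^esub> b = c then f a \<otimes> g b else \<zero>)"
proof -
  let ?P = "{(a, b). f a \<noteq> \<zero> \<and> g b \<noteq> \<zero> \<and> a \<otimes>\<^bsub>M\<^esub> b = c}"
  have sub: "?P \<subseteq> A \<times> B"
    using A B by auto
  have "(f \<otimes>\<^bsub>alg\<^esub> g) c = finsum K (\<lambda>(a, b). f a \<otimes> g b) ?P"
    using c by (simp add: binoid_algebra_def)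
  also have "\<dots> = finsum K (\<lambda>(a, b). if a \<otimes>\<^bsub>M\<^esub> b = c then f a \<otimes> g b else \<zero>) (A \<times> B)"
    using sub A B coeff_closed[OF f] coeff_closed[OF g]
    by (intro R.add.finprod_mono_neutral_cong) (auto dest: finite_subset split: if_splits)
  also have "\<dots> = (\<Oplus>a\<in>A. \<Oplus>b\<in>B. if a \<otimes>\<^bsub>M\<^esub> b = c then f a \<otimes> g b else \<zero>)"
    using A B coeff_closed[OF f] coeff_closed[OF g] by (intro R.finsum_Times) auto
  finally show ?thesis .
qed

lemma mult_closed:
  assumes f: "f \<in> carrier alg" and g: "g \<in> carrier alg"
  shows "f \<otimes>\<^bsub>alg\<^esub> g \<in> carrier alg"
    and "supp (f \<otimes>\<^bsub>alg\<^esub> g) \<subseteq> (\<lambda>(a, b). a \<otimes>\<^bsub>M\<^esub> b) ` (supp f \<times> supp g)"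
proof -
  note mult = alg_mult[OF f g _ finite_supp[OF f] subset_refl finite_supp[OF g] subset_refl]
  show supp: "supp (f \<otimes>\<^bsub>alg\<^esub> g) \<subseteq> (\<lambda>(a, b). a \<otimes>\<^bsub>M\<^esub> b) ` (supp f \<times> supp g)"
  proof
    fix c assume c: "c \<in> supp (f \<otimes>\<^bsub>alg\<^esub> g)"
    show "c \<in> (\<lambda>(a, b). a \<otimes>\<^bsub>M\<^esub> b) ` (supp f \<times> supp g)"
    proof (rule ccontr)
      assume notin: "c \<notin> (\<lambda>(a, b). a \<otimes>\<^bsub>M\<^esub> b) ` (supp f \<times> supp g)"
      have "c \<in> nonabsorb M"
        using c alg_mult_outside by blast
      moreover have "(\<Oplus>a\<in>supp f. \<Oplus>b\<in>supp g. if a \<otimes>\<^bsub>M\<^esub> b = c then f a \<otimes> g b else \<zero>) = \<zero>"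
        using notin by (intro R.add.finprod_one_eqI) auto
      ultimately show False
        using c mult by simp
    qed
  qed
  have "(f \<otimes>\<^bsub>alg\<^esub> g) c \<in> carrier K" for c
  proof (cases "c \<in> nonabsorb M")
    case True
    then show ?thesis
      using coeff_closed[OF f] coeff_closed[OF g]
      by (simp add: mult Pi_def)
  qed (simp add: alg_mult_outside)
  moreover have "finite (supp (f \<otimes>\<^bsub>alg\<^esub> g))"
    using finite_supp[OF f] finite_supp[OF g] by (intro finite_subset[OF supp]) simp
  moreover have "supp (f \<otimes>\<^bsub>alg\<^esub> g) \<subseteq> nonabsorb M"
    using alg_mult_outside by blast
  ultimately show "f \<otimes>\<^bsub>alg\<^esub> g \<in> carrier alg"
    by (simp add: alg_carrier)
qed

text \<open>A linear functional with weights \<open>u\<close> is evaluated on a product without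
  mentioning the coefficients of the product; this is how iterated products are expanded. The
  condition on \<open>u (absorb M)\<close> kills the pairs with product \<open>absorb M\<close>,
  which the right-hand side still sums over but the algebra discards.\<close>

lemma finsum_against_mult:
  assumes f: "f \<in> carrier alg" and g: "g \<in> carrier alg"
    and C: "finite C" "supp (f \<otimes>\<^bsub>alg\<^esub> g) \<subseteq> C"
    and u: "\<And>c. u c \<in> carrier K" "u (absorb M) = \<zero>"
  shows "(\<Oplus>c\<in>C. u c \<otimes> (f \<otimes>\<^bsub>alg\<^esub> g) c)
    = (\<Oplus>a\<in>supp f. \<Oplus>b\<in>supp g. u (a \<otimes>\<^bsub>M\<^esub> b) \<otimes> (f a \<otimes> g b))"
proof -
  note cl = coeff_closed[OF f] coeff_closed[OF g] u(1)
    and fin = finite_supp[OF f] finite_supp[OF g]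
  have fg: "f \<otimes>\<^bsub>alg\<^esub> g \<in> carrier alg"
    using mult_closed(1)[OF f g] .
  \<comment> \<open>The set \<open>C\<close> may miss a product of support elements at which the
    coefficients cancel. In \<open>C'\<close> every such product occurs as an index, so the
    innermost sum over \<open>c\<close> collapses to a single term.\<close>
  define C' where "C' = C \<union> (\<lambda>(a, b). a \<otimes>\<^bsub>M\<^esub> b) ` (supp f \<times> supp g)"
  have C': "finite C'" "C \<subseteq> C'"
    using C fin by (auto simp: C'_def)
  let ?t = "\<lambda>c a b. if a \<otimes>\<^bsub>M\<^esub> b = c then u c \<otimes> (f a \<otimes> g b) else \<zero>"
  have expand: "u c \<otimes> (f \<otimes>\<^bsub>alg\<^esub> g) c = (\<Oplus>a\<in>supp f. \<Oplus>b\<in>supp g. ?t c a b)" for c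
  proof (cases "c \<in> nonabsorb M")
    case True
    let ?s = "\<lambda>a b. if a \<otimes>\<^bsub>M\<^esub> b = c then f a \<otimes> g b else \<zero>"
    have "u c \<otimes> (f \<otimes>\<^bsub>alg\<^esub> g) c = (\<Oplus>a\<in>supp f. u c \<otimes> (\<Oplus>b\<in>supp g. ?s a b))"
      using alg_mult[OF f g True fin(1) subset_refl fin(2) subset_refl] fin cl
      by (simp only:) (rule R.finsum_rdistr, auto intro!: R.finsum_closed)
    also have "\<dots> = (\<Oplus>a\<in>supp f. \<Oplus>b\<in>supp g. u c \<otimes> ?s a b)"
      using fin cl by (intro R.finsum_cong' R.finsum_rdistr) (auto intro!: R.finsum_closed)
    also have "\<dots> = (\<Oplus>a\<in>supp f. \<Oplus>b\<in>supp g. ?t c a b)"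
      using fin cl by (intro R.finsum_cong') (auto intro!: R.finsum_closed)
    finally show ?thesis .
  next
    \<comment> \<open>The coefficient of the product is zero here. On the other side, a product of
      support elements lies in the carrier, so it can equal \<open>c\<close> only if
      \<open>c\<close> is \<open>absorb M\<close>, where the weight vanishes.\<close>
    case False
    have "a \<otimes>\<^bsub>M\<^esub> b = c \<Longrightarrow> u c = \<zero>" if "a \<in> supp f" "b \<in> supp g" for a b
      using that False u(2) supp_nonabsorb[OF f] supp_nonabsorb[OF g]
      by (auto simp: nonabsorb_def)
    then have "(\<Oplus>a\<in>supp f. \<Oplus>b\<in>supp g. ?t c a b) = \<zero>"
      using cl by (intro R.add.finprod_one_eqI) auto
    then show ?thesis
      using False cl by (simp add: alg_mult_outside)
  qed
  have "(\<Oplus>c\<in>C. u c \<otimes> (f \<otimes>\<^bsub>alg\<^esub> g) c) = (\<Oplus>c\<in>C'. u c \<otimes> (f \<otimes>\<^bsub>alg\<^esub> g) c)"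
  proof (intro R.add.finprod_mono_neutral_cong_left)
    fix c assume "c \<in> C' - C"
    then have "(f \<otimes>\<^bsub>alg\<^esub> g) c = \<zero>"
      using C(2) by blast
    then show "u c \<otimes> (f \<otimes>\<^bsub>alg\<^esub> g) c = \<zero>"
      using u(1) by simp
  qed (use C' cl coeff_closed[OF fg] in auto)
  also have "\<dots> = (\<Oplus>c\<in>C'. \<Oplus>a\<in>supp f. \<Oplus>b\<in>supp g. ?t c a b)"
    by (simp add: expand)
  also have "\<dots> = (\<Oplus>a\<in>supp f. \<Oplus>c\<in>C'. \<Oplus>b\<in>supp g. ?t c a b)"
    using C' fin cl by (intro R.finsum_swap) (auto intro!: R.finsum_closed)
  also have "\<dots> = (\<Oplus>a\<in>supp f. \<Oplus>b\<in>supp g. \<Oplus>c\<in>C'. ?t c a b)"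
    using C' fin cl by (intro R.finsum_cong' R.finsum_swap) (auto intro!: R.finsum_closed)
  also have "\<dots> = (\<Oplus>a\<in>supp f. \<Oplus>b\<in>supp g. u (a \<otimes>\<^bsub>M\<^esub> b) \<otimes> (f a \<otimes> g b))"
    using C' fin cl
    by (intro R.finsum_cong' R.finsum_delta) (auto simp: C'_def intro!: R.finsum_closed)
  finally show ?thesis .
qed

lemma mult_commute:
  assumes f: "f \<in> carrier alg" and g: "g \<in> carrier alg"
  shows "f \<otimes>\<^bsub>alg\<^esub> g = g \<otimes>\<^bsub>alg\<^esub> f"
proof
  fix c
  note cl = coeff_closed[OF f] coeff_closed[OF g]
    and fin = finite_supp[OF f] finite_supp[OF g]
  show "(f \<otimes>\<^bsub>alg\<^esub> g) c = (g \<otimes>\<^bsub>alg\<^esub> f) c"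
  proof (cases "c \<in> nonabsorb M")
    case True
    have comm: "a \<otimes>\<^bsub>M\<^esub> b = b \<otimes>\<^bsub>M\<^esub> a" if "a \<in> supp f" "b \<in> supp g" for a b
      using that supp_nonabsorb[OF f] supp_nonabsorb[OF g]
      by (auto intro!: M.m_comm nonabsorb_closed)
    have "(f \<otimes>\<^bsub>alg\<^esub> g) c
        = (\<Oplus>b\<in>supp g. \<Oplus>a\<in>supp f. if a \<otimes>\<^bsub>M\<^esub> b = c then f a \<otimes> g b else \<zero>)"
      unfolding alg_mult[OF f g True fin(1) subset_refl fin(2) subset_refl]
      using fin cl by (intro R.finsum_swap) auto
    also have "\<dots> = (\<Oplus>b\<in>supp g. \<Oplus>a\<in>supp f. if b \<otimes>\<^bsub>M\<^esub> a = c then g b \<otimes> f a else \<zero>)"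
      using fin cl comm by (intro R.finsum_cong') (auto simp: R.m_comm intro!: R.finsum_closed)
    also have "\<dots> = (g \<otimes>\<^bsub>alg\<^esub> f) c"
      using alg_mult[OF g f True fin(2) subset_refl fin(1) subset_refl] by simp
    finally show ?thesis .
  qed (simp add: alg_mult_outside)
qed

text \<open>For fixed \<open>d\<close> in the support of \<open>h\<close>, the outer product is a
  weighted sum of the coefficients of the inner one, with weight \<open>h d\<close> where c d = e
  and zero elsewhere. This weight vanishes at \<open>absorb M\<close> because
  \<open>absorb M\<close> times \<open>d\<close> is again \<open>absorb M\<close>, which differs
  from \<open>e\<close>.\<close>

lemma mult_mult_coeff:
  assumes f: "f \<in> carrier alg" and g: "g \<in> carrier alg" and h: "h \<in> carrier alg"
    and e: "e \<in> nonabsorb M"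
  shows "((f \<otimes>\<^bsub>alg\<^esub> g) \<otimes>\<^bsub>alg\<^esub> h) e = (\<Oplus>d\<in>supp h. \<Oplus>a\<in>supp f. \<Oplus>b\<in>supp g.
    if a \<otimes>\<^bsub>M\<^esub> b \<otimes>\<^bsub>M\<^esub> d = e then f a \<otimes> g b \<otimes> h d else \<zero>)"
proof -
  note cl = coeff_closed[OF f] coeff_closed[OF g] coeff_closed[OF h]
    and fin = finite_supp[OF f] finite_supp[OF g] finite_supp[OF h]
  note fg = mult_closed(1)[OF f g]
  let ?fg = "f \<otimes>\<^bsub>alg\<^esub> g"
  let ?u = "\<lambda>d c. if c \<otimes>\<^bsub>M\<^esub> d = e then h d else \<zero>"
  have "(?fg \<otimes>\<^bsub>alg\<^esub> h) e
      = (\<Oplus>d\<in>supp h. \<Oplus>c\<in>supp ?fg. if c \<otimes>\<^bsub>M\<^esub> d = e then ?fg c \<otimes> h d else \<zero>)"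
    unfolding alg_mult[OF fg h e finite_supp[OF fg] subset_refl fin(3) subset_refl]
    using fin finite_supp[OF fg] cl coeff_closed[OF fg] by (intro R.finsum_swap) auto
  also have "\<dots> = (\<Oplus>d\<in>supp h. \<Oplus>c\<in>supp ?fg. ?u d c \<otimes> ?fg c)"
    using cl coeff_closed[OF fg]
    by (intro R.finsum_cong') (auto simp: R.m_comm intro!: R.finsum_closed)
  also have "\<dots> = (\<Oplus>d\<in>supp h. \<Oplus>a\<in>supp f. \<Oplus>b\<in>supp g. ?u d (a \<otimes>\<^bsub>M\<^esub> b) \<otimes> (f a \<otimes> g b))"
  proof (rule R.finsum_cong'[OF refl])
    fix d assume "d \<in> supp h"
    then have d: "d \<in> carrier M"
      using supp_closed[OF h] by blast
    have "?u d (absorb M) = \<zero>"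
      using e M.absorb_mult[OF d] by (auto simp: nonabsorb_def)
    then show "(\<Oplus>c\<in>supp ?fg. ?u d c \<otimes> ?fg c)
        = (\<Oplus>a\<in>supp f. \<Oplus>b\<in>supp g. ?u d (a \<otimes>\<^bsub>M\<^esub> b) \<otimes> (f a \<otimes> g b))"
      using cl by (intro finsum_against_mult[OF f g finite_supp[OF fg] subset_refl]) auto
  qed (use cl in \<open>auto intro!: R.finsum_closed\<close>)
  also have "\<dots> = (\<Oplus>d\<in>supp h. \<Oplus>a\<in>supp f. \<Oplus>b\<in>supp g.
      if a \<otimes>\<^bsub>M\<^esub> b \<otimes>\<^bsub>M\<^esub> d = e then f a \<otimes> g b \<otimes> h d else \<zero>)"
    using cl by (intro R.finsum_cong') (auto simp: R.m_comm intro!: R.finsum_closed)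
  finally show ?thesis .
qed

text \<open>The triple sum is invariant under cyclic rotation of the three factors, so (f g) h = (g
  h) f, and commutativity turns the latter into f (g h). Thus only left-bracketed products have to
  be expanded.\<close>

lemma mult_assoc:
  assumes f: "f \<in> carrier alg" and g: "g \<in> carrier alg" and h: "h \<in> carrier alg"
  shows "(f \<otimes>\<^bsub>alg\<^esub> g) \<otimes>\<^bsub>alg\<^esub> h = f \<otimes>\<^bsub>alg\<^esub> (g \<otimes>\<^bsub>alg\<^esub> h)"
proof -
  note cl = coeff_closed[OF f] coeff_closed[OF g] coeff_closed[OF h]
    and fin = finite_supp[OF f] finite_supp[OF g] finite_supp[OF h]
  have sub: "supp f \<subseteq> carrier M" "supp g \<subseteq> carrier M" "supp h \<subseteq> carrier M"
    using f g h by (simp_all add: supp_closed)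
  have rotate: "(if a \<otimes>\<^bsub>M\<^esub> b \<otimes>\<^bsub>M\<^esub> d = e then f a \<otimes> g b \<otimes> h d else \<zero>)
      = (if b \<otimes>\<^bsub>M\<^esub> d \<otimes>\<^bsub>M\<^esub> a = e then g b \<otimes> h d \<otimes> f a else \<zero>)"
    if "a \<in> supp f" "b \<in> supp g" "d \<in> supp h" for a b d e
  proof -
    have "a \<in> carrier M" "b \<in> carrier M" "d \<in> carrier M"
      using that sub by auto
    then have "a \<otimes>\<^bsub>M\<^esub> b \<otimes>\<^bsub>M\<^esub> d = b \<otimes>\<^bsub>M\<^esub> d \<otimes>\<^bsub>M\<^esub> a"
      by (simp add: M.m_assoc M.m_comm[of a])
    moreover have "f a \<otimes> g b \<otimes> h d = g b \<otimes> h d \<otimes> f a"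
      using cl by (simp add: R.m_assoc R.m_comm[of "f a"])
    ultimately show ?thesis
      by simp
  qed
  have "((f \<otimes>\<^bsub>alg\<^esub> g) \<otimes>\<^bsub>alg\<^esub> h) e = ((g \<otimes>\<^bsub>alg\<^esub> h) \<otimes>\<^bsub>alg\<^esub> f) e" for e
  proof (cases "e \<in> nonabsorb M")
    case True
    let ?t = "\<lambda>d a b. if a \<otimes>\<^bsub>M\<^esub> b \<otimes>\<^bsub>M\<^esub> d = e then f a \<otimes> g b \<otimes> h d else \<zero>"
    have "((f \<otimes>\<^bsub>alg\<^esub> g) \<otimes>\<^bsub>alg\<^esub> h) e
        = (\<Oplus>a\<in>supp f. \<Oplus>d\<in>supp h. \<Oplus>b\<in>supp g. ?t d a b)"
      unfolding mult_mult_coeff[OF f g h True]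
      using fin cl by (intro R.finsum_swap) (auto intro!: R.finsum_closed)
    also have "\<dots> = (\<Oplus>a\<in>supp f. \<Oplus>b\<in>supp g. \<Oplus>d\<in>supp h. ?t d a b)"
      using fin cl by (intro R.finsum_cong' R.finsum_swap) (auto intro!: R.finsum_closed)
    also have "\<dots> = (\<Oplus>a\<in>supp f. \<Oplus>b\<in>supp g. \<Oplus>d\<in>supp h.
        if b \<otimes>\<^bsub>M\<^esub> d \<otimes>\<^bsub>M\<^esub> a = e then g b \<otimes> h d \<otimes> f a else \<zero>)"
      using cl by (intro R.finsum_cong' refl rotate) (auto intro!: R.finsum_closed)
    also have "\<dots> = ((g \<otimes>\<^bsub>alg\<^esub> h) \<otimes>\<^bsub>alg\<^esub> f) e"
      using mult_mult_coeff[OF g h f True] by simp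
    finally show ?thesis .
  qed (simp add: alg_mult_outside)
  then show ?thesis
    using mult_commute[OF f mult_closed(1)[OF g h]] by auto
qed

lemma monomial_closed: "k \<in> carrier K \<Longrightarrow> a \<in> carrier M \<Longrightarrow> monomial k a \<in> carrier alg"
  using finite_subset[of "supp (monomial k a)" "{a}"]
  by (auto simp: alg_carrier monomial_def nonabsorb_def)

lemma monomial_absorb: "monomial k (absorb M) = \<zero>\<^bsub>alg\<^esub>"
  by (auto simp: monomial_def alg_zero)

lemma supp_monomial: "supp (monomial k a) \<subseteq> {a}"
  by (auto simp: monomial_def)

lemma monomial_mult_monomial:
  assumes k: "k \<in> carrier K" and l: "l \<in> carrier K" and a: "a \<in> carrier M" and b: "b \<in> carrier M"
  shows "monomial k a \<otimes>\<^bsub>alg\<^esub> monomial l b = monomial (k \<otimes> l) (a \<otimes>\<^bsub>M\<^esub> b)"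
proof
  fix c
  show "(monomial k a \<otimes>\<^bsub>alg\<^esub> monomial l b) c = monomial (k \<otimes> l) (a \<otimes>\<^bsub>M\<^esub> b) c"
  proof (cases "c \<in> nonabsorb M")
    case True
    \<comment> \<open>If a factor were absorbing, so would be the product \<open>c\<close>. Hence
      neither monomial has been truncated to zero in the case that contributes.\<close>
    have "a \<noteq> absorb M \<and> b \<noteq> absorb M" if "a \<otimes>\<^bsub>M\<^esub> b = c"
      using that True a b M.absorb_mult M.m_comm[OF a b] by (auto simp: nonabsorb_def)
    then show ?thesis
      using alg_mult[OF monomial_closed[OF k a] monomial_closed[OF l b] True, of "{a}" "{b}"]
        supp_monomial[of k a] supp_monomial[of l b] True k l
      by (auto simp: monomial_def nonabsorb_def)
  next
    case False
    then show ?thesis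
      using M.m_closed[OF a b] by (auto simp: alg_mult_outside monomial_def nonabsorb_def)
  qed
qed

lemma one_mult:
  assumes f: "f \<in> carrier alg"
  shows "\<one>\<^bsub>alg\<^esub> \<otimes>\<^bsub>alg\<^esub> f = f"
proof
  fix c
  show "(\<one>\<^bsub>alg\<^esub> \<otimes>\<^bsub>alg\<^esub> f) c = f c"
  proof (cases "c \<in> nonabsorb M")
    case True
    \<comment> \<open>The index \<open>c\<close> is inserted because it need not lie in the support
      of \<open>f\<close>, and the final delta sum has to contain it.\<close>
    let ?B = "insert c (supp f)"
    have B: "finite ?B" "supp f \<subseteq> ?B" "?B \<subseteq> carrier M"
      using finite_supp[OF f] supp_closed[OF f] nonabsorb_closed[OF True] by auto
    have "\<one>\<^bsub>M\<^esub> \<noteq> absorb M"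
      using True by (metis M.absorb_mult M.l_one absorb_not_nonabsorb nonabsorb_closed)
    moreover have "(\<one>\<^bsub>alg\<^esub> \<otimes>\<^bsub>alg\<^esub> f) c = (\<Oplus>b\<in>?B.
        if \<one>\<^bsub>M\<^esub> \<otimes>\<^bsub>M\<^esub> b = c then monomial \<one> \<one>\<^bsub>M\<^esub> \<one>\<^bsub>M\<^esub> \<otimes> f b else \<zero>)"
      using alg_mult[OF monomial_closed[OF R.one_closed M.one_closed] f True _ supp_monomial B(1,2)]
        coeff_closed[OF f] by (simp add: alg_one monomial_def)
    ultimately have "(\<one>\<^bsub>alg\<^esub> \<otimes>\<^bsub>alg\<^esub> f) c = (\<Oplus>b\<in>?B. if \<one>\<^bsub>M\<^esub> \<otimes>\<^bsub>M\<^esub> b = c then f b else \<zero>)"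
      using coeff_closed[OF f] by (simp add: monomial_def cong: if_cong)
    also have "\<dots> = (\<Oplus>b\<in>?B. if c = b then f b else \<zero>)"
      using B(3) coeff_closed[OF f] by (intro R.finsum_cong') (auto simp: subset_iff)
    also have "\<dots> = f c"
      using B(1) coeff_closed[OF f] by (intro R.finsum_delta) auto
    finally show ?thesis .
  qed (use coeff_outside[OF f] in \<open>simp add: alg_mult_outside\<close>)
qed

lemma supp_add: "supp (f \<oplus>\<^bsub>alg\<^esub> g) \<subseteq> supp f \<union> supp g"
  by (auto simp: alg_add)

lemma add_closed:
  assumes f: "f \<in> carrier alg" and g: "g \<in> carrier alg"
  shows "f \<oplus>\<^bsub>alg\<^esub> g \<in> carrier alg"
proof -
  have "finite (supp (f \<oplus>\<^bsub>alg\<^esub> g))"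
    using finite_supp[OF f] finite_supp[OF g] by (intro finite_subset[OF supp_add]) simp
  moreover have "(f \<oplus>\<^bsub>alg\<^esub> g) c \<in> carrier K" for c
    using coeff_closed[OF f] coeff_closed[OF g] by (simp add: alg_add)
  moreover have "supp (f \<oplus>\<^bsub>alg\<^esub> g) \<subseteq> nonabsorb M"
    using supp_add[of f g] supp_nonabsorb[OF f] supp_nonabsorb[OF g] by blast
  ultimately show ?thesis
    by (simp add: alg_carrier)
qed

lemma l_distr:
  assumes f: "f \<in> carrier alg" and g: "g \<in> carrier alg" and h: "h \<in> carrier alg"
  shows "(f \<oplus>\<^bsub>alg\<^esub> g) \<otimes>\<^bsub>alg\<^esub> h = f \<otimes>\<^bsub>alg\<^esub> h \<oplus>\<^bsub>alg\<^esub> g \<otimes>\<^bsub>alg\<^esub> h"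
proof
  fix c
  note cl = coeff_closed[OF f] coeff_closed[OF g] coeff_closed[OF h]
  show "((f \<oplus>\<^bsub>alg\<^esub> g) \<otimes>\<^bsub>alg\<^esub> h) c = (f \<otimes>\<^bsub>alg\<^esub> h \<oplus>\<^bsub>alg\<^esub> g \<otimes>\<^bsub>alg\<^esub> h) c"
  proof (cases "c \<in> nonabsorb M")
    case True
    let ?A = "supp f \<union> supp g"
    let ?s = "\<lambda>k a b. if a \<otimes>\<^bsub>M\<^esub> b = c then k a \<otimes> h b else \<zero>"
    have A: "finite ?A" "supp f \<subseteq> ?A" "supp g \<subseteq> ?A" "supp (f \<oplus>\<^bsub>alg\<^esub> g) \<subseteq> ?A"
      using f g by (auto simp: finite_supp alg_add)
    note mult = alg_mult[OF _ h True A(1) _ finite_supp[OF h] subset_refl]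
    have "((f \<oplus>\<^bsub>alg\<^esub> g) \<otimes>\<^bsub>alg\<^esub> h) c = (\<Oplus>a\<in>?A. \<Oplus>b\<in>supp h. ?s f a b \<oplus> ?s g a b)"
      unfolding mult[OF add_closed[OF f g] A(4)] using cl
      by (intro R.finsum_cong') (auto simp: alg_add R.l_distr intro!: R.finsum_closed)
    also have "\<dots> = (\<Oplus>a\<in>?A. (\<Oplus>b\<in>supp h. ?s f a b) \<oplus> (\<Oplus>b\<in>supp h. ?s g a b))"
      using cl by (intro R.finsum_cong' R.finsum_addf) (auto intro!: R.finsum_closed)
    also have "\<dots> = (\<Oplus>a\<in>?A. \<Oplus>b\<in>supp h. ?s f a b) \<oplus> (\<Oplus>a\<in>?A. \<Oplus>b\<in>supp h. ?s g a b)"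
      using cl by (intro R.finsum_addf) (auto intro!: R.finsum_closed)
    also have "\<dots> = (f \<otimes>\<^bsub>alg\<^esub> h \<oplus>\<^bsub>alg\<^esub> g \<otimes>\<^bsub>alg\<^esub> h) c"
      using mult[OF f A(2)] mult[OF g A(3)] by (simp add: alg_add)
    finally show ?thesis .
  qed (simp add: alg_mult_outside alg_add)
qed

lemma neg_closed: "f \<in> carrier alg \<Longrightarrow> (\<lambda>c. \<ominus> f c) \<in> carrier alg"
  unfolding alg_carrier by simp

lemma cring_alg: "cring alg"
proof (rule cringI)
  show "abelian_group alg"
  proof (rule abelian_groupI)
    fix f assume f: "f \<in> carrier alg"
    then have "(\<lambda>c. \<ominus> f c) \<oplus>\<^bsub>alg\<^esub> f = \<zero>\<^bsub>alg\<^esub>"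
      using coeff_closed[OF f] by (simp add: alg_add alg_zero R.l_neg)
    then show "\<exists>g\<in>carrier alg. g \<oplus>\<^bsub>alg\<^esub> f = \<zero>\<^bsub>alg\<^esub>"
      using neg_closed[OF f] by blast
  qed (auto simp: alg_add alg_zero alg_carrier R.a_ac add_closed[unfolded alg_carrier alg_add])
  show "comm_monoid alg"
    using mult_closed(1) mult_assoc mult_commute one_mult monomial_closed[OF R.one_closed M.one_closed]
    by (intro comm_monoidI) (simp_all add: alg_one)
qed (rule l_distr)

lemma supp_minus: "f \<in> carrier alg \<Longrightarrow> supp (\<ominus>\<^bsub>alg\<^esub> f) = supp f"
proof -
  assume f: "f \<in> carrier alg"
  interpret A: cring alg by (rule cring_alg)
  have "(\<lambda>c. \<ominus> f c) \<oplus>\<^bsub>alg\<^esub> f = \<zero>\<^bsub>alg\<^esub>"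
    using coeff_closed[OF f] by (simp add: alg_add alg_zero R.l_neg)
  then have "\<ominus>\<^bsub>alg\<^esub> f = (\<lambda>c. \<ominus> f c)"
    using A.minus_equality f neg_closed[OF f] by blast
  then show ?thesis
    using coeff_closed[OF f] by auto
qed

end

section \<open>Pushforward of sheaves\<close>

text \<open>In both spectra a generating set D(f) that contains a prime contains every smaller
  prime. This lemma carries that property over to all open sets.\<close>

lemma generate_topology_on_specialization:
  assumes "generate_topology_on \<B> U" "x \<in> U" "\<And>B. B \<in> \<B> \<Longrightarrow> x \<in> B \<Longrightarrow> y \<in> B"
  shows "y \<in> U"
  using assms by (induction rule: generate_topology_on.induct) auto

lemma presheaf_restr_closed:
  assumes "ab_presheaf S F" "openin S U" "openin S V" "V \<subseteq> U" "s \<in> carrier (sections F U)"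
  shows "restr F U V s \<in> carrier (sections F V)"
proof -
  have "restr F U V \<in> hom (sections F U) (sections F V)"
    using assms(1-4) by (simp add: ab_presheaf_def)
  then show ?thesis
    using assms(5) by (rule hom_in_carrier)
qed

lemma presheaf_restr_restr:
  assumes "ab_presheaf S F" "openin S U" "openin S V" "openin S W" "W \<subseteq> V" "V \<subseteq> U"
    and "s \<in> carrier (sections F U)"
  shows "restr F V W (restr F U V s) = restr F U W s"
  using assms unfolding ab_presheaf_def by blast

locale sheaf_pushforward =
  fixes S :: "'a topology" and T :: "'e topology" and f :: "'a \<Rightarrow> 'e"
  assumes continuous: "continuous_map S T f"
begin

abbreviation pre where "pre \<equiv> open_preimage S f"

lemma open_pre: "openin T V \<Longrightarrow> openin S (pre V)"
  unfolding open_preimage_def using continuous by (rule openin_continuous_map_preimage)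

lemma pre_mono: "V \<subseteq> W \<Longrightarrow> pre V \<subseteq> pre W"
  by (auto simp: open_preimage_def)

lemma pre_Union: "pre (\<Union>\<U>) = \<Union>(pre ` \<U>)"
  by (auto simp: open_preimage_def)

lemma pre_Int: "pre (V \<inter> W) = pre V \<inter> pre W"
  by (auto simp: open_preimage_def)

lemma ab_presheaf_pushforward:
  assumes "ab_presheaf S F"
  shows "ab_presheaf T (pushforward S f F)"
  using assms open_pre pre_mono unfolding ab_presheaf_def pushforward_def by simp

text \<open>A cover in \<open>T\<close> is pulled back to a cover in \<open>S\<close>. Distinct
  members of the cover may have the same preimage, so before gluing, a family indexed by the cover
  must be shown to descend to a family indexed by preimages.\<close>

lemma ab_sheaf_pushforward:
  assumes F: "ab_sheaf S F"
  shows "ab_sheaf T (pushforward S f F)"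
  unfolding ab_sheaf_def
proof (intro conjI allI impI)
  have psh: "ab_presheaf S F"
    using F by (simp add: ab_sheaf_def)
  then show "ab_presheaf T (pushforward S f F)"
    by (rule ab_presheaf_pushforward)
  fix \<U> assume \<U>: "\<forall>V\<in>\<U>. openin T V"
  then have cover: "\<forall>V\<in>pre ` \<U>. openin S V"
    using open_pre by auto
  show "\<forall>s\<in>carrier (sections (pushforward S f F) (\<Union>\<U>)).
      \<forall>t\<in>carrier (sections (pushforward S f F) (\<Union>\<U>)).
      (\<forall>V\<in>\<U>. restr (pushforward S f F) (\<Union>\<U>) V s = restr (pushforward S f F) (\<Union>\<U>) V t) \<longrightarrow> s = t"
  proof (intro ballI impI)
    fix s t
    assume st: "s \<in> carrier (sections (pushforward S f F) (\<Union>\<U>))"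
        "t \<in> carrier (sections (pushforward S f F) (\<Union>\<U>))"
      and "\<forall>V\<in>\<U>. restr (pushforward S f F) (\<Union>\<U>) V s = restr (pushforward S f F) (\<Union>\<U>) V t"
    then have "\<forall>Y\<in>pre ` \<U>. restr F (\<Union>(pre ` \<U>)) Y s = restr F (\<Union>(pre ` \<U>)) Y t"
      by (simp add: pushforward_def pre_Union)
    moreover have "s \<in> carrier (sections F (\<Union>(pre ` \<U>)))" "t \<in> carrier (sections F (\<Union>(pre ` \<U>)))"
      using st by (simp_all add: pushforward_def pre_Union)
    ultimately show "s = t"
      using F cover unfolding ab_sheaf_def by blast
  qed
  fix s
  assume s: "(\<forall>V\<in>\<U>. s V \<in> carrier (sections (pushforward S f F) V)) \<and>
    (\<forall>V\<in>\<U>. \<forall>W\<in>\<U>. restr (pushforward S f F) V (V \<inter> W) (s V)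
                  = restr (pushforward S f F) W (V \<inter> W) (s W))"
  have s_closed: "s V \<in> carrier (sections F (pre V))" if "V \<in> \<U>" for V
    using that s by (simp add: pushforward_def)
  have s_agree: "restr F (pre V) (pre V \<inter> pre W) (s V) = restr F (pre W) (pre V \<inter> pre W) (s W)"
    if "V \<in> \<U>" "W \<in> \<U>" for V W
  proof -
    have "restr (pushforward S f F) V (V \<inter> W) (s V) = restr (pushforward S f F) W (V \<inter> W) (s W)"
      using s that by blast
    then show ?thesis
      by (simp add: pushforward_def pre_Int)
  qed
  \<comment> \<open>When the preimages coincide, the preimage of the overlap is that same set, so
    agreement on the overlap is already equality.\<close>
  have s_eq: "s V = s W" if VW: "V \<in> \<U>" "W \<in> \<U>" and eq: "pre V = pre W" for V W
  proof -
    have "restr F (pre V) (pre V) (s V) = restr F (pre V) (pre V) (s W)"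
      using s_agree[OF VW] eq by simp
    moreover have "openin S (pre V)"
      using \<U> VW open_pre by blast
    ultimately show ?thesis
      using psh s_closed[OF VW(1)] s_closed[OF VW(2)] eq by (simp add: ab_presheaf_def)
  qed
  \<comment> \<open>The gluing axiom for \<open>F\<close> asks for a section for each open set of
    \<open>S\<close>; by \<open>s_eq\<close> the chosen member of the cover does not matter.\<close>
  define r where "r Y = s (SOME V. V \<in> \<U> \<and> pre V = Y)" for Y
  have r: "r (pre V) = s V" if "V \<in> \<U>" for V
  proof -
    have "(SOME W. W \<in> \<U> \<and> pre W = pre V) \<in> \<U> \<and> pre (SOME W. W \<in> \<U> \<and> pre W = pre V) = pre V"
      using that by (intro someI[of "\<lambda>W. W \<in> \<U> \<and> pre W = pre V"]) auto
    then show ?thesis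
      using s_eq that unfolding r_def by blast
  qed
  have "\<exists>t\<in>carrier (sections F (\<Union>(pre ` \<U>))). \<forall>Y\<in>pre ` \<U>. restr F (\<Union>(pre ` \<U>)) Y t = r Y"
  proof -
    have "(\<forall>Y\<in>pre ` \<U>. r Y \<in> carrier (sections F Y)) \<and>
      (\<forall>Y\<in>pre ` \<U>. \<forall>Z\<in>pre ` \<U>. restr F Y (Y \<inter> Z) (r Y) = restr F Z (Y \<inter> Z) (r Z))"
      using s_closed s_agree r by auto
    then show ?thesis
      using F cover unfolding ab_sheaf_def by blast
  qed
  then show "\<exists>t\<in>carrier (sections (pushforward S f F) (\<Union>\<U>)).
      \<forall>V\<in>\<U>. restr (pushforward S f F) (\<Union>\<U>) V t = s V"
    using r by (auto simp: pushforward_def pre_Union)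
qed

lemma sheaf_hom_pushforward:
  assumes "sheaf_hom S F G \<phi>"
  shows "sheaf_hom T (pushforward S f F) (pushforward S f G) (pushforward_hom S f \<phi>)"
  using assms open_pre pre_mono
  unfolding sheaf_hom_def pushforward_def pushforward_hom_def by simp

end

text \<open>
  The last assumption says that the stalk of a pushforward at \<open>y\<close> is the stalk at a single point
  \<open>x\<close> of \<open>S\<close>: the preimages of small neighbourhoods of \<open>y\<close> equal the least open set
  containing \<open>x\<close>.
\<close>

locale focal_map = sheaf_pushforward +
  assumes focal: "\<And>U y. \<lbrakk>openin T U; y \<in> U\<rbrakk> \<Longrightarrow>
    \<exists>W. openin T W \<and> y \<in> W \<and> W \<subseteq> U \<and>
      (\<exists>x\<in>open_preimage S f W. \<forall>V. openin S V \<and> x \<in> V \<longrightarrow> open_preimage S f W \<subseteq> V)"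
begin

text \<open>Covers pull back, which gives one inclusion. Conversely, a cover of \<open>pre U\<close>
  need not come from \<open>T\<close>; but by \<open>focal\<close> each point of \<open>U\<close>
  has a neighbourhood \<open>W\<close> whose preimage lies inside every open set around some
  \<open>x\<close>. It therefore lies inside a single member of the cover, and the lift given there
  restricts to \<open>pre W\<close>.\<close>

lemma sheaf_image_pushforward:
  assumes F: "ab_presheaf S F" and G: "ab_presheaf S G" and \<phi>: "sheaf_hom S F G \<phi>"
    and U: "openin T U"
  shows "sheaf_image T (pushforward S f F) (pushforward S f G) (pushforward_hom S f \<phi>) U
    = sheaf_image S F G \<phi> (pre U)"
proof (intro Set.set_eqI iffI)
  fix t assume "t \<in> sheaf_image T (pushforward S f F) (pushforward S f G) (pushforward_hom S f \<phi>) U"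
  then have t: "t \<in> carrier (sections G (pre U))"
    and "\<exists>\<U>. (\<forall>V\<in>\<U>. openin T V) \<and> \<Union>\<U> = U \<and>
      (\<forall>V\<in>\<U>. restr G (pre U) (pre V) t \<in> \<phi> (pre V) ` carrier (sections F (pre V)))"
    by (simp_all add: sheaf_image_def pushforward_def pushforward_hom_def)
  then obtain \<U> where \<U>: "\<forall>V\<in>\<U>. openin T V" "\<Union>\<U> = U"
    "\<forall>V\<in>\<U>. restr G (pre U) (pre V) t \<in> \<phi> (pre V) ` carrier (sections F (pre V))"
    by blast
  have "\<forall>V\<in>pre ` \<U>. openin S V" "\<Union>(pre ` \<U>) = pre U"
    "\<forall>V\<in>pre ` \<U>. restr G (pre U) V t \<in> \<phi> V ` carrier (sections F V)"
    using \<U> open_pre pre_Union by auto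
  then show "t \<in> sheaf_image S F G \<phi> (pre U)"
    using t unfolding sheaf_image_def by blast
next
  fix t assume "t \<in> sheaf_image S F G \<phi> (pre U)"
  then have t: "t \<in> carrier (sections G (pre U))"
    and "\<exists>\<V>. (\<forall>V\<in>\<V>. openin S V) \<and> \<Union>\<V> = pre U \<and>
      (\<forall>V\<in>\<V>. restr G (pre U) V t \<in> \<phi> V ` carrier (sections F V))"
    by (simp_all add: sheaf_image_def)
  then obtain \<V> where \<V>: "\<forall>V\<in>\<V>. openin S V" "\<Union>\<V> = pre U"
    "\<forall>V\<in>\<V>. restr G (pre U) V t \<in> \<phi> V ` carrier (sections F V)"
    by (elim exE conjE)
  \<comment> \<open>All open subsets over which \<open>t\<close> lifts are taken at once, so it only
    remains to see that they cover \<open>U\<close>.\<close>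
  define \<U> where "\<U> = {W. openin T W \<and> W \<subseteq> U \<and>
    restr G (pre U) (pre W) t \<in> \<phi> (pre W) ` carrier (sections F (pre W))}"
  have "y \<in> \<Union>\<U>" if y: "y \<in> U" for y
  proof -
    obtain W x where W: "openin T W" "y \<in> W" "W \<subseteq> U" "x \<in> pre W"
      and "\<forall>V. openin S V \<and> x \<in> V \<longrightarrow> pre W \<subseteq> V"
      using focal[OF U y] by (elim exE conjE bexE)
    then have least: "pre W \<subseteq> V" if "openin S V" "x \<in> V" for V
      using that by simp
    obtain V where V: "V \<in> \<V>" "x \<in> V"
      using pre_mono[OF W(3)] W(4) \<V>(2) by blast
    note open_V = bspec[OF \<V>(1) V(1)]
    have sub: "pre W \<subseteq> V" "V \<subseteq> pre U"
      using least[OF open_V V(2)] V(1) \<V>(2) by auto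
    obtain s where s: "s \<in> carrier (sections F V)" "restr G (pre U) V t = \<phi> V s"
      using bspec[OF \<V>(3) V(1)] by auto
    have "restr G (pre U) (pre W) t = restr G V (pre W) (\<phi> V s)"
      using presheaf_restr_restr[OF G open_pre[OF U] open_V open_pre[OF W(1)] sub t] s(2) by simp
    also have "\<dots> = \<phi> (pre W) (restr F V (pre W) s)"
      using \<phi> s(1) open_V sub open_pre[OF W(1)] unfolding sheaf_hom_def by simp
    finally have "restr G (pre U) (pre W) t = \<phi> (pre W) (restr F V (pre W) s)" .
    moreover have "restr F V (pre W) s \<in> carrier (sections F (pre W))"
      using presheaf_restr_closed[OF F open_V open_pre[OF W(1)] sub(1) s(1)] .
    ultimately have "W \<in> \<U>"
      using W(1,3) unfolding \<U>_def by blast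
    then show ?thesis
      using W(2) by auto
  qed
  then have "\<Union>\<U> = U"
    unfolding \<U>_def by blast
  moreover have "\<forall>V\<in>\<U>. openin T V \<and>
      restr G (pre U) (pre V) t \<in> \<phi> (pre V) ` carrier (sections F (pre V))"
    by (simp add: \<U>_def)
  ultimately show "t \<in> sheaf_image T (pushforward S f F) (pushforward S f G) (pushforward_hom S f \<phi>) U"
    using t by (simp add: sheaf_image_def pushforward_def pushforward_hom_def) blast
qed

text \<open>The kernel conditions are stated open set by open set, so they are instances of those on
  \<open>S\<close> at preimages. The image conditions transfer by
  \<open>sheaf_image_pushforward\<close>.\<close>

theorem short_exact_pushforward:
  assumes "short_exact_sheaves S F \<phi> G \<psi> H"
  shows "short_exact_sheaves T
    (pushforward S f F) (pushforward_hom S f \<phi>)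
    (pushforward S f G) (pushforward_hom S f \<psi>)
    (pushforward S f H)"
proof -
  have sheaves: "ab_sheaf S F" "ab_sheaf S G" "ab_sheaf S H"
    and homs: "sheaf_hom S F G \<phi>" "sheaf_hom S G H \<psi>"
    using assms by (auto simp: short_exact_sheaves_def)
  then have presheaves: "ab_presheaf S F" "ab_presheaf S G" "ab_presheaf S H"
    by (simp_all add: ab_sheaf_def)
  have "sheaf_image T (pushforward S f F) (pushforward S f G) (pushforward_hom S f \<phi>) U
      = sheaf_image S F G \<phi> (pre U)"
    "sheaf_image T (pushforward S f G) (pushforward S f H) (pushforward_hom S f \<psi>) U
      = sheaf_image S G H \<psi> (pre U)" if "openin T U" for U
    using sheaf_image_pushforward[OF presheaves(1,2) homs(1) that]
      sheaf_image_pushforward[OF presheaves(2,3) homs(2) that] by simp_all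
  then show ?thesis
    using assms open_pre ab_sheaf_pushforward[OF sheaves(1)] ab_sheaf_pushforward[OF sheaves(2)]
      ab_sheaf_pushforward[OF sheaves(3)] sheaf_hom_pushforward[OF homs(1)]
      sheaf_hom_pushforward[OF homs(2)]
    unfolding short_exact_sheaves_def
    by (simp add: pushforward_def pushforward_hom_def)
qed

end

section \<open>Spectra of binoids and binoid algebras\<close>

lemma binoid_prime_absorb: "binoid_prime p M \<Longrightarrow> absorb M \<in> p"
  by (simp add: binoid_prime_def)

lemma binoid_prime_ideal: "binoid_prime p M \<Longrightarrow> a \<in> p \<Longrightarrow> b \<in> carrier M \<Longrightarrow> a \<otimes>\<^bsub>M\<^esub> b \<in> p"
  by (simp add: binoid_prime_def)

lemma binoid_prime_one: "binoid_prime p M \<Longrightarrow> \<one>\<^bsub>M\<^esub> \<notin> p"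
  unfolding binoid_prime_def using submonoid.one_closed by blast

lemma binoid_prime_mult:
  "\<lbrakk>binoid_prime p M; a \<in> carrier M - p; b \<in> carrier M - p\<rbrakk> \<Longrightarrow> a \<otimes>\<^bsub>M\<^esub> b \<in> carrier M - p"
  unfolding binoid_prime_def using submonoid.m_closed[of "carrier M - p" M a b] by blast

lemma openin_ring_Spec_basis:
  "f \<in> carrier R \<Longrightarrow> openin (ring_Spec R) {P. primeideal P R \<and> f \<notin> P}"
  unfolding ring_Spec_def by (rule topology_generated_by_Basis) blast

lemma primeideal_one_notin: "primeideal P R \<Longrightarrow> \<one>\<^bsub>R\<^esub> \<notin> P"
  using ideal.one_imp_carrier primeideal.I_notcarr primeideal.axioms(1) by blast

section \<open>Complements of primes and least neighbourhoods in Spec M\<close>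

context binoid
begin

text \<open>Products and powers of elements outside \<open>p\<close> stay outside \<open>p\<close>,
  hence never equal \<open>absorb M\<close>. The exceptions allowed in both hypotheses on
  \<open>M\<close> therefore do not occur.\<close>

lemma complement_torsion_free_monoid:
  assumes p: "binoid_prime p M"
    and canc: "cancellative_binoid M" and tf: "torsion_free_up_to_nilpotence M"
  shows "torsion_free_monoid (M\<lparr>carrier := carrier M - p\<rparr>)"
proof -
  let ?S = "carrier M - p"
  have nonabsorb: "a \<noteq> absorb M" if "a \<in> ?S" for a
    using that binoid_prime_absorb[OF p] by auto
  have one: "\<one> \<in> ?S"
    using binoid_prime_one[OF p] by simp
  note mult = binoid_prime_mult[OF p]
  have pow: "a [^] n \<in> ?S" if "a \<in> ?S" for a and n :: nat
    using that by (induction n) (simp_all only: nat_pow_0 nat_pow_Suc one mult)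
  show ?thesis
  proof
    fix a b c
    assume "a \<in> carrier (M\<lparr>carrier := ?S\<rparr>)" "b \<in> carrier (M\<lparr>carrier := ?S\<rparr>)" "c \<in> carrier (M\<lparr>carrier := ?S\<rparr>)"
      and "a \<otimes>\<^bsub>M\<lparr>carrier := ?S\<rparr>\<^esub> c = b \<otimes>\<^bsub>M\<lparr>carrier := ?S\<rparr>\<^esub> c"
    then have S: "a \<in> ?S" "b \<in> ?S" "c \<in> ?S" and eq: "a \<otimes> c = b \<otimes> c"
      by simp_all
    then have "c \<otimes> a = c \<otimes> b"
      by (simp add: m_comm)
    moreover have "c \<otimes> b \<noteq> absorb M"
      using mult[OF S(3,2)] nonabsorb by auto
    ultimately show "a = b"
      using canc S unfolding cancellative_binoid_def by blast
  next
    fix a b and n :: nat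
    assume "a \<in> carrier (M\<lparr>carrier := ?S\<rparr>)" "b \<in> carrier (M\<lparr>carrier := ?S\<rparr>)"
      and n: "1 \<le> n" and "a [^]\<^bsub>M\<lparr>carrier := ?S\<rparr>\<^esub> n = b [^]\<^bsub>M\<lparr>carrier := ?S\<rparr>\<^esub> n"
    then have S: "a \<in> ?S" "b \<in> ?S" and eq: "a [^] n = b [^] n"
      by (simp_all flip: nat_pow_consistent)
    have "b [^] n \<noteq> absorb M"
      using pow[OF S(2)] nonabsorb by blast
    then show "a = b"
      using tf S n eq unfolding torsion_free_up_to_nilpotence_def by blast
  qed (use one mult in \<open>simp_all add: m_ac\<close>)
qed

lemma topspace_binoid_Spec: "topspace (binoid_Spec M) = {p. binoid_prime p M}"
  unfolding binoid_Spec_def topology_generated_by_topspace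
  using binoid_prime_one by blast

lemma openin_binoid_Spec_basis:
  "a \<in> carrier M \<Longrightarrow> openin (binoid_Spec M) {p. binoid_prime p M \<and> a \<notin> p}"
  unfolding binoid_Spec_def by (rule topology_generated_by_Basis) blast

lemma binoid_Spec_generization:
  assumes "openin (binoid_Spec M) U" "q \<in> U" "binoid_prime p M" "p \<subseteq> q"
  shows "p \<in> U"
  using assms unfolding binoid_Spec_def openin_topology_generated_by_iff
  by (auto elim!: generate_topology_on_specialization)

text \<open>
  The witness is the product of the generators outside \<open>q\<close>, and \<open>D(a)\<close> is the least open
  neighbourhood of \<open>q\<close>.
\<close>

lemma exists_least_neighbourhood:
  assumes fg: "fin_gen_binoid M" and q: "binoid_prime q M"
  shows "\<exists>a\<in>carrier M - q. \<forall>p. binoid_prime p M \<and> a \<notin> p \<longrightarrow> p \<subseteq> q"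
proof -
  obtain A where A: "finite A" "A \<subseteq> carrier M"
    and gen: "carrier M = \<Inter>{H. submonoid H M \<and> absorb M \<in> H \<and> A \<subseteq> H}"
    using fg unfolding fin_gen_binoid_def by blast
  \<comment> \<open>The claim is first restricted to generators. A new generator outside
    \<open>q\<close> is multiplied into the witness: if the product avoids a prime ideal, so do both
    factors.\<close>
  have "\<exists>a\<in>carrier M - q. \<forall>p. binoid_prime p M \<and> a \<notin> p \<longrightarrow> p \<inter> (A - q) = {}"
    using A
  proof (induction A rule: finite_induct)
    case empty
    then show ?case
      using binoid_prime_one[OF q] by auto
  next
    case (insert x A)
    then obtain a where a: "a \<in> carrier M - q"
      "\<And>p. binoid_prime p M \<Longrightarrow> a \<notin> p \<Longrightarrow> p \<inter> (A - q) = {}"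
      by auto
    show ?case
    proof (cases "x \<in> q")
      case True
      then show ?thesis using a by auto
    next
      case False
      then have x: "x \<in> carrier M - q"
        using insert.prems by auto
      have "p \<inter> (insert x A - q) = {}" if p: "binoid_prime p M" and "x \<otimes> a \<notin> p" for p
      proof -
        have "x \<notin> p"
          using that a(1) binoid_prime_ideal[OF p] by blast
        moreover have "a \<notin> p"
          using that a(1) x binoid_prime_ideal[OF p, of a x] m_comm[of a x] by auto
        ultimately show ?thesis
          using a(2)[OF p] by auto
      qed
      then show ?thesis
        using binoid_prime_mult[OF q x a(1)] by blast
    qed
  qed
  then obtain a where a: "a \<in> carrier M - q"
    "\<And>p. binoid_prime p M \<Longrightarrow> a \<notin> p \<Longrightarrow> p \<inter> (A - q) = {}"
    by blast
  have "p \<subseteq> q" if p: "binoid_prime p M" and ap: "a \<notin> p" for p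
  proof -
    \<comment> \<open>This is the set of elements whose membership in \<open>p\<close> implies
      membership in \<open>q\<close>. It is a submonoid containing \<open>absorb M\<close> and all
      generators, hence all of \<open>M\<close>.\<close>
    let ?H = "q \<union> (carrier M - p)"
    have pq: "p \<subseteq> carrier M" "q \<subseteq> carrier M"
      using p q by (simp_all add: binoid_prime_def)
    have "submonoid ?H M"
    proof
      show "?H \<subseteq> carrier M"
        using pq by auto
      show "\<one> \<in> ?H"
        using binoid_prime_one[OF p] by simp
      fix x y assume xy: "x \<in> ?H" "y \<in> ?H"
      then have cl: "x \<in> carrier M" "y \<in> carrier M"
        using pq by auto
      consider "x \<in> q" | "y \<in> q" | "x \<in> carrier M - p" "y \<in> carrier M - p"
        using xy by blast
      then show "x \<otimes> y \<in> ?H"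
      proof cases
        case 1
        then show ?thesis using binoid_prime_ideal[OF q _ cl(2)] by blast
      next
        case 2
        then show ?thesis using binoid_prime_ideal[OF q _ cl(1)] m_comm[OF cl] by simp
      next
        case 3
        then show ?thesis using binoid_prime_mult[OF p] by blast
      qed
    qed
    moreover have "absorb M \<in> ?H"
      using binoid_prime_absorb[OF q] by simp
    moreover have "A \<subseteq> ?H"
      using A(2) a(2)[OF p ap] by blast
    ultimately have "carrier M \<subseteq> ?H"
      using gen by blast
    then show ?thesis
      using pq by blast
  qed
  then show ?thesis
    using a(1) by blast
qed

end

section \<open>The map on spectra: primality, continuity and the focal property\<close>

context binoid_coeffs
begin

lemma mem_ideal_extension:
  "f \<in> ideal_extension K M p \<longleftrightarrow> f \<in> carrier alg \<and> supp f \<subseteq> p"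
  by (simp add: ideal_extension_def)

lemma ideal_extension_additive_subgroup: "additive_subgroup (ideal_extension K M p) alg"
proof -
  interpret A: cring alg by (rule cring_alg)
  show ?thesis
  proof (intro additive_subgroupI A.add.subgroupI)
    show "ideal_extension K M p \<noteq> {}"
      using A.zero_closed by (auto simp: mem_ideal_extension alg_zero)
  next
    fix f g assume "f \<in> ideal_extension K M p" "g \<in> ideal_extension K M p"
    then have "f \<in> carrier alg" "g \<in> carrier alg" "supp f \<union> supp g \<subseteq> p"
      by (auto simp: mem_ideal_extension)
    then show "f \<oplus>\<^bsub>alg\<^esub> g \<in> ideal_extension K M p"
      using add_closed supp_add[of f g] unfolding mem_ideal_extension by blast
  qed (auto simp: mem_ideal_extension supp_minus)
qed

text \<open>For primality, \<open>unique_product\<close> is applied to the parts of the two supports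
  outside \<open>p\<close>. At the resulting exponent the product has the single term
  \<open>f a\<^sub>0 \<otimes> g b\<^sub>0\<close>, nonzero in a domain, and that exponent is
  outside \<open>p\<close>.\<close>

lemma primeideal_ideal_extension:
  assumes K: "domain K" and p: "binoid_prime p M"
    and canc: "cancellative_binoid M" and tf: "torsion_free_up_to_nilpotence M"
  shows "primeideal (ideal_extension K M p) alg"
proof (rule primeidealI2[OF ideal_extension_additive_subgroup cring_alg])
  fix f g assume f: "f \<in> ideal_extension K M p" and g: "g \<in> carrier alg"
  then have f': "f \<in> carrier alg" "supp f \<subseteq> p"
    by (simp_all add: mem_ideal_extension)
  have "(\<lambda>(a, b). a \<otimes>\<^bsub>M\<^esub> b) ` (supp f \<times> supp g) \<subseteq> p"
  proof
    fix c assume "c \<in> (\<lambda>(a, b). a \<otimes>\<^bsub>M\<^esub> b) ` (supp f \<times> supp g)"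
    then obtain a b where "c = a \<otimes>\<^bsub>M\<^esub> b" "a \<in> supp f" "b \<in> supp g"
      by (elim imageE) (auto split: prod.splits)
    moreover from this have "a \<in> p" "b \<in> carrier M"
      using f'(2) supp_closed[OF g] by blast+
    ultimately show "c \<in> p"
      using binoid_prime_ideal[OF p] by simp
  qed
  with mult_closed(2)[OF f'(1) g] have "supp (f \<otimes>\<^bsub>alg\<^esub> g) \<subseteq> p"
    by (rule subset_trans)
  then show "f \<otimes>\<^bsub>alg\<^esub> g \<in> ideal_extension K M p"
    using mult_closed(1)[OF f'(1) g] by (simp add: mem_ideal_extension)
  then show "g \<otimes>\<^bsub>alg\<^esub> f \<in> ideal_extension K M p"
    using mult_commute[OF f'(1) g] by simp
next
  have "\<one>\<^bsub>M\<^esub> \<noteq> absorb M"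
    using binoid_prime_one[OF p] binoid_prime_absorb[OF p] by auto
  moreover have "\<one> \<noteq> \<zero>"
    using K by (rule domain.one_not_zero)
  ultimately have "monomial \<one> \<one>\<^bsub>M\<^esub> \<one>\<^bsub>M\<^esub> \<noteq> \<zero>"
    by (simp add: monomial_def)
  then have "monomial \<one> \<one>\<^bsub>M\<^esub> \<notin> ideal_extension K M p"
    using binoid_prime_one[OF p] by (auto simp: mem_ideal_extension)
  then show "carrier alg \<noteq> ideal_extension K M p"
    using monomial_closed[OF R.one_closed M.one_closed] by blast
next
  fix f g
  assume f: "f \<in> carrier alg" and g: "g \<in> carrier alg" and fg: "f \<otimes>\<^bsub>alg\<^esub> g \<in> ideal_extension K M p"
  show "f \<in> ideal_extension K M p \<or> g \<in> ideal_extension K M p"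
  proof (rule ccontr)
    assume "\<not> ?thesis"
    then have nonempty: "supp f - p \<noteq> {}" "supp g - p \<noteq> {}"
      using f g by (auto simp: mem_ideal_extension)
    interpret N: torsion_free_monoid "M\<lparr>carrier := carrier M - p\<rparr>"
      using p canc tf by (rule M.complement_torsion_free_monoid)
    note cl = coeff_closed[OF f] coeff_closed[OF g]
      and fin = finite_supp[OF f] finite_supp[OF g]
    let ?N = "M\<lparr>carrier := carrier M - p\<rparr>"
    have sub: "supp f - p \<subseteq> carrier ?N" "supp g - p \<subseteq> carrier ?N"
      using supp_closed[OF f] supp_closed[OF g] by auto
    obtain a\<^sub>0 b\<^sub>0 where a0: "a\<^sub>0 \<in> supp f - p" and b0: "b\<^sub>0 \<in> supp g - p"
      and "\<forall>a\<in>supp f - p. \<forall>b\<in>supp g - p. a \<otimes>\<^bsub>?N\<^esub> b = a\<^sub>0 \<otimes>\<^bsub>?N\<^esub> b\<^sub>0 \<longrightarrow> a = a\<^sub>0 \<and> b = b\<^sub>0"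
      using N.unique_product[OF finite_Diff[OF fin(1)] nonempty(1) sub(1)
            finite_Diff[OF fin(2)] nonempty(2) sub(2)] by (elim bexE)
    then have unique: "a = a\<^sub>0 \<and> b = b\<^sub>0"
      if "a \<in> supp f - p" "b \<in> supp g - p" "a \<otimes>\<^bsub>M\<^esub> b = a\<^sub>0 \<otimes>\<^bsub>M\<^esub> b\<^sub>0" for a b
      using that by simp
    let ?c = "a\<^sub>0 \<otimes>\<^bsub>M\<^esub> b\<^sub>0"
    have c: "?c \<in> carrier M - p"
      using a0 b0 supp_closed[OF f] supp_closed[OF g] by (intro binoid_prime_mult[OF p]) auto
    then have "?c \<in> nonabsorb M"
      using binoid_prime_absorb[OF p] by (auto simp: nonabsorb_def)
    then have "(f \<otimes>\<^bsub>alg\<^esub> g) ?c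
        = (\<Oplus>a\<in>supp f. \<Oplus>b\<in>supp g. if a \<otimes>\<^bsub>M\<^esub> b = ?c then f a \<otimes> g b else \<zero>)"
      using alg_mult[OF f g _ fin(1) subset_refl fin(2) subset_refl] by simp
    also have "\<dots> = (\<Oplus>a\<in>supp f. if a\<^sub>0 = a then f a \<otimes> g b\<^sub>0 else \<zero>)"
    proof (rule R.finsum_cong'[OF refl])
      fix a assume a: "a \<in> supp f"
      \<comment> \<open>The exponent \<open>?c\<close> is not in the ideal \<open>p\<close>, so
        neither factor is in \<open>p\<close> and uniqueness applies; terms with an exponent in
        \<open>p\<close> cannot interfere.\<close>
      have only: "a = a\<^sub>0 \<and> b = b\<^sub>0" if b: "b \<in> supp g" and eq: "a \<otimes>\<^bsub>M\<^esub> b = ?c" for b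
      proof -
        have "a \<in> carrier M" "b \<in> carrier M"
          using a b supp_closed[OF f] supp_closed[OF g] by auto
        then have "a \<notin> p" "b \<notin> p"
          using c eq binoid_prime_ideal[OF p, of a b] binoid_prime_ideal[OF p, of b a] M.m_comm[of a b]
          by auto
        then show ?thesis
          using a b eq unique by blast
      qed
      \<comment> \<open>The condition on the pair is split into nested deltas, one for each of the
        two sums.\<close>
      have "(if a \<otimes>\<^bsub>M\<^esub> b = ?c then f a \<otimes> g b else \<zero>)
          = (if b\<^sub>0 = b then (if a\<^sub>0 = a then f a \<otimes> g b else \<zero>) else \<zero>)" if "b \<in> supp g" for b
      proof (cases "a \<otimes>\<^bsub>M\<^esub> b = ?c")
        case True
        from only[OF that this] show ?thesis by simp
      next
        case False
        then have "\<not> (b\<^sub>0 = b \<and> a\<^sub>0 = a)"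
          by blast
        with False show ?thesis by simp
      qed
      then have "(\<Oplus>b\<in>supp g. if a \<otimes>\<^bsub>M\<^esub> b = ?c then f a \<otimes> g b else \<zero>)
          = (\<Oplus>b\<in>supp g. if b\<^sub>0 = b then (if a\<^sub>0 = a then f a \<otimes> g b else \<zero>) else \<zero>)"
        using cl by (intro R.finsum_cong' refl) simp_all
      also have "\<dots> = (if a\<^sub>0 = a then f a \<otimes> g b\<^sub>0 else \<zero>)"
        using fin b0 cl by (intro R.finsum_delta) auto
      finally show "(\<Oplus>b\<in>supp g. if a \<otimes>\<^bsub>M\<^esub> b = ?c then f a \<otimes> g b else \<zero>)
          = (if a\<^sub>0 = a then f a \<otimes> g b\<^sub>0 else \<zero>)" .
    qed (use cl in auto)
    also have "\<dots> = f a\<^sub>0 \<otimes> g b\<^sub>0"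
      using fin a0 cl by (intro R.finsum_delta) auto
    finally have "(f \<otimes>\<^bsub>alg\<^esub> g) ?c \<noteq> \<zero>"
      using a0 b0 cl domain.integral[OF K, of "f a\<^sub>0" "g b\<^sub>0"] by auto
    then show False
      using fg c by (auto simp: mem_ideal_extension)
  qed
qed

text \<open>An element lies outside K[p] exactly when some exponent of its support lies outside
  \<open>p\<close>. So the preimage of D(f) is the union of the D(a) for \<open>a\<close> in the
  support of \<open>f\<close>.\<close>

lemma continuous_ideal_extension:
  assumes prime: "\<And>p. binoid_prime p M \<Longrightarrow> primeideal (ideal_extension K M p) alg"
  shows "continuous_map (binoid_Spec M) (ring_Spec alg) (ideal_extension K M)"
  unfolding ring_Spec_def
proof (rule continuous_on_generated_topo)
  interpret A: cring alg by (rule cring_alg)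
  show "ideal_extension K M ` topspace (binoid_Spec M)
      \<subseteq> \<Union> {{P. primeideal P alg \<and> f \<notin> P} | f. f \<in> carrier alg}"
    using prime primeideal_one_notin A.one_closed unfolding M.topspace_binoid_Spec by blast
  fix U assume "U \<in> {{P. primeideal P alg \<and> f \<notin> P} | f. f \<in> carrier alg}"
  then obtain f where f: "f \<in> carrier alg" and U: "U = {P. primeideal P alg \<and> f \<notin> P}"
    by blast
  have "ideal_extension K M -` U \<inter> topspace (binoid_Spec M)
      = (\<Union>a\<in>supp f. {p. binoid_prime p M \<and> a \<notin> p})"
    using f prime by (auto simp: U M.topspace_binoid_Spec mem_ideal_extension)
  also have "openin (binoid_Spec M) \<dots>"
    using supp_closed[OF f] by (intro openin_Union) (auto intro!: M.openin_binoid_Spec_basis)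
  finally show "openin (binoid_Spec M) (ideal_extension K M -` U \<inter> topspace (binoid_Spec M))" .
qed

abbreviation contraction where "contraction P \<equiv> {a \<in> carrier M. monomial \<one> a \<in> P}"

text \<open>Sending \<open>a\<close> to T^a is multiplicative, so the ideal and primality properties
  of \<open>P\<close> pull back; \<open>absorb M\<close> is included because its monomial is
  zero.\<close>

lemma binoid_prime_contraction:
  assumes P: "primeideal P alg"
  shows "binoid_prime (contraction P) M"
proof -
  interpret P: primeideal P alg by (rule P)
  show ?thesis
    unfolding binoid_prime_def
  proof (intro conjI ballI)
    show "absorb M \<in> contraction P"
      using M.absorb_closed by (simp add: monomial_absorb)
    show "a \<otimes>\<^bsub>M\<^esub> b \<in> contraction P"
      if "a \<in> contraction P" "b \<in> carrier M" for a b
      using that P.I_r_closed[of "monomial \<one> a" "monomial \<one> b"]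
      by (simp add: monomial_closed monomial_mult_monomial)
    show "submonoid (carrier M - contraction P) M"
    proof
      show "\<one>\<^bsub>M\<^esub> \<in> carrier M - contraction P"
        using primeideal_one_notin[OF P] by (simp add: alg_one)
      fix a b
      assume "a \<in> carrier M - contraction P"
        "b \<in> carrier M - contraction P"
      then show "a \<otimes>\<^bsub>M\<^esub> b \<in> carrier M - contraction P"
        using P.I_prime[of "monomial \<one> a" "monomial \<one> b"]
        by (auto simp: monomial_closed monomial_mult_monomial)
    qed auto
  qed auto
qed

text \<open>Each element is a finite sum of scalar multiples of monomials in \<open>P\<close>. The
  induction runs over a finite set containing the support and splits off one coefficient at a
  time.\<close>

lemma ideal_extension_contraction:
  assumes P: "primeideal P alg"
  shows "ideal_extension K M (contraction P) \<subseteq> P"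
proof
  interpret P: primeideal P alg by (rule P)
  fix f assume "f \<in> ideal_extension K M (contraction P)"
  then have f: "f \<in> carrier alg" "supp f \<subseteq> contraction P"
    by (simp_all add: mem_ideal_extension)
  have "g \<in> P" if "finite A" "A \<subseteq> contraction P" "g \<in> carrier alg" "supp g \<subseteq> A" for A g
    using that
  proof (induction A arbitrary: g rule: finite_induct)
    case empty
    then have "g = \<zero>\<^bsub>alg\<^esub>"
      by (auto simp: alg_zero)
    then show ?case
      by simp
  next
    case (insert x A)
    let ?h = "g(x := \<zero>)"
    have x: "x \<in> carrier M" "monomial \<one> x \<in> P" and gx: "g x \<in> carrier K"
      using insert.prems coeff_closed by auto
    \<comment> \<open>The scalar \<open>g x\<close> acts as the algebra element
      \<open>monomial (g x) \<one>\<close>, so closure under ring multiplication gives closure under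
      scalars.\<close>
    have "monomial (g x) \<one>\<^bsub>M\<^esub> \<otimes>\<^bsub>alg\<^esub> monomial \<one> x \<in> P"
      using x gx by (intro P.I_l_closed monomial_closed) auto
    then have term_mem: "monomial (g x) x \<in> P"
      using x gx by (simp add: monomial_mult_monomial)
    have supp_h: "supp ?h \<subseteq> supp g" "supp ?h \<subseteq> A"
      using insert.prems by auto
    have "?h \<in> carrier alg"
      using insert.prems(2) supp_h(1) finite_subset[OF supp_h(1)] by (auto simp: alg_carrier)
    then have "?h \<in> P"
      using insert.IH insert.prems supp_h(2) by blast
    \<comment> \<open>The contraction contains \<open>absorb M\<close>, so \<open>x\<close> may be
      that element; its monomial is then zero, and so is the coefficient.\<close>
    moreover have "g x = \<zero>" if "x = absorb M"
      using that coeff_outside[OF insert.prems(2)] by simp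
    then have "?h \<oplus>\<^bsub>alg\<^esub> monomial (g x) x = g"
      using gx coeff_closed[OF insert.prems(2)] by (auto simp: alg_add monomial_def)
    ultimately show ?case
      using additive_subgroup.a_closed[OF P.is_additive_subgroup _ term_mem] by metis
  qed
  from this[OF finite_supp[OF f(1)] f(2) f(1)] show "f \<in> P"
    by simp
qed

lemma focal_ideal_extension:
  assumes prime: "\<And>p. binoid_prime p M \<Longrightarrow> primeideal (ideal_extension K M p) alg"
    and fg: "fin_gen_binoid M"
  shows "focal_map (binoid_Spec M) (ring_Spec alg) (ideal_extension K M)"
proof
  show "continuous_map (binoid_Spec M) (ring_Spec alg) (ideal_extension K M)"
    using prime by (rule continuous_ideal_extension)
  fix U P assume U: "openin (ring_Spec alg) U" and PU: "P \<in> U"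
  have P: "primeideal P alg"
    using openin_subset[OF U] PU unfolding ring_Spec_def topology_generated_by_topspace by auto
  let ?q = "contraction P"
  have q: "binoid_prime ?q M"
    by (rule binoid_prime_contraction[OF P])
  \<comment> \<open>Each basic open set around \<open>P\<close> contains the smaller prime
    K[q].\<close>
  have q_mem_U: "ideal_extension K M ?q \<in> U"
    using U PU prime[OF q] ideal_extension_contraction[OF P]
    unfolding ring_Spec_def openin_topology_generated_by_iff
    by (auto elim!: generate_topology_on_specialization)
  obtain a where a: "a \<in> carrier M - ?q" "\<And>p. binoid_prime p M \<Longrightarrow> a \<notin> p \<Longrightarrow> p \<subseteq> ?q"
    using M.exists_least_neighbourhood[OF fg q] by blast
  \<comment> \<open>As \<open>a\<close> is outside the contraction, its monomial is outside
    \<open>P\<close> and hence nonzero, so its support is exactly one point. This makes the preimage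
    of D(T^a) equal to D(a).\<close>
  have "monomial \<one> a \<noteq> \<zero>\<^bsub>alg\<^esub>"
    using a(1) additive_subgroup.zero_closed[OF ideal.axioms(1)[OF primeideal.axioms(1)[OF P]]] by auto
  then have "supp (monomial \<one> a) = {a}"
    using supp_monomial[of \<one> a] by (auto simp: alg_zero)
  then have mem_iff: "monomial \<one> a \<in> ideal_extension K M p \<longleftrightarrow> a \<in> p" for p
    using monomial_closed[OF R.one_closed] a(1) by (simp add: mem_ideal_extension)
  \<comment> \<open>Intersecting \<open>U\<close> with D(T^a) forces the preimage into D(a), whose
    members are all contained in \<open>?q\<close> and therefore belong to every open set around
    \<open>?q\<close>.\<close>
  let ?W = "U \<inter> {P. primeideal P alg \<and> monomial \<one> a \<notin> P}"
  have "openin (ring_Spec alg) ?W"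
    using U a(1) by (intro openin_Int openin_ring_Spec_basis) (auto intro: monomial_closed)
  moreover have "P \<in> ?W"
    using PU P a(1) by auto
  moreover have "?q \<in> open_preimage (binoid_Spec M) (ideal_extension K M) ?W"
    using q a(1) q_mem_U prime[OF q] mem_iff
    by (simp add: open_preimage_def M.topspace_binoid_Spec)
  moreover have "open_preimage (binoid_Spec M) (ideal_extension K M) ?W \<subseteq> V"
    if V: "openin (binoid_Spec M) V" "?q \<in> V" for V
  proof
    fix p assume "p \<in> open_preimage (binoid_Spec M) (ideal_extension K M) ?W"
    then have "binoid_prime p M" "a \<notin> p"
      using mem_iff by (simp_all add: open_preimage_def M.topspace_binoid_Spec)
    then show "p \<in> V"
      using M.binoid_Spec_generization[OF V] a(2) by blast
  qed
  ultimately show "\<exists>W. openin (ring_Spec alg) W \<and> P \<in> W \<and> W \<subseteq> U \<and>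
      (\<exists>x\<in>open_preimage (binoid_Spec M) (ideal_extension K M) W.
        \<forall>V. openin (binoid_Spec M) V \<and> x \<in> V \<longrightarrow>
          open_preimage (binoid_Spec M) (ideal_extension K M) W \<subseteq> V)"
    by (intro exI[of _ ?W]) blast
qed

end

theorem theorem3p44:
  fixes K :: "('k, 'x) ring_scheme"
    and M :: "('m, 'y) binoid_scheme"
    and F :: "('m set, 'b) presheaf"
    and G :: "('m set, 'c) presheaf"
    and H :: "('m set, 'd) presheaf"
    and \<phi> :: "'m set set \<Rightarrow> 'b \<Rightarrow> 'c"
    and \<psi> :: "'m set set \<Rightarrow> 'c \<Rightarrow> 'd"
  assumes "field K"
    and "binoid M"
    and "fin_gen_binoid M"
    and "cancellative_binoid M"
    and "torsion_free_up_to_nilpotence M"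
    and "short_exact_sheaves (binoid_Spec M) F \<phi> G \<psi> H"
  shows "short_exact_sheaves (ring_Spec (binoid_algebra K M))
    (pushforward (binoid_Spec M) (ideal_extension K M) F)
      (pushforward_hom (binoid_Spec M) (ideal_extension K M) \<phi>)
    (pushforward (binoid_Spec M) (ideal_extension K M) G)
      (pushforward_hom (binoid_Spec M) (ideal_extension K M) \<psi>)
    (pushforward (binoid_Spec M) (ideal_extension K M) H)"
proof -
  interpret K: field K by fact
  interpret M: binoid M by fact
  interpret binoid_coeffs K M ..
  interpret focal_map "binoid_Spec M" "ring_Spec (binoid_algebra K M)" "ideal_extension K M"
    using primeideal_ideal_extension[OF K.domain_axioms _ assms(4,5)] assms(3)
    by (rule focal_ideal_extension)
  show ?thesis
    using assms(6) by (rule short_exact_pushforward)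
qed

end
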